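(* Let $\alpha=(\alpha_1,1) \in \mathbb{R}^2$ with $0<\alpha_1<1$ irrational, and let $P \subseteq [0,1]^2$ be a convex polygon with edges $e_1, \ldots, e_N$. Suppose that no edge of $P$ is parallel to $\alpha$, and for each $1 \le k \le N$ let $\phi_k$ be an angle such that $\alpha$ rotated by $\phi_k$ in the positive direction is parallel to $e_k$. Then for any starting point $s \in [0,1]^2$ and any $T>0$, \[ |\Delta_T (s, \alpha, P)| \le 2 + \frac{N+1}{\pi^2 |\alpha |} \max_{1 \le k<\ell \le N} \left| \cot \phi_k - \cot \phi_{\ell} \right| \sum_{n=1}^{\infty} \frac{1}{n^2 \| n \alpha_1 \|}. \]
   Context: $\|x\|$ denotes the distance from $x\in\mathbb{R}$ to the nearest integer, $|\alpha|$ the Euclidean norm, and $\{x\}$ the fractional part. For $s \in [0,1]^2$, a set $A \subseteq [0,1]^2$ with characteristic function $\chi_A$, and $T>0$, \[ \Delta_T (s, \alpha, A)=\int_0^T \chi_A(\{ s_1+t\alpha_1 \}, \{ s_2+t\alpha_2 \}) \, \mathrm{d}t - T \lambda(A), \] where $\lambda$ is Lebesgue measure. *)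

theory Defs
  imports "HOL-Analysis.Analysis"
begin

definition unit_square :: "(real \<times> real) set" where
  "unit_square = {0..1} \<times> {0..1}"

definition dist_nearest_int :: "real \<Rightarrow> real" where
  "dist_nearest_int x = \<bar>x - of_int (round x)\<bar>"

definition discrepancy ::
  "real \<Rightarrow> real \<times> real \<Rightarrow> real \<times> real \<Rightarrow> (real \<times> real) set \<Rightarrow> real" where
  "discrepancy T s \<alpha> A =
     (LINT t:{0..T}|lebesgue. indicat_real A (frac (fst s + t * fst \<alpha>), frac (snd s + t * snd \<alpha>)))
     - T * measure lebesgue A"

text \<open>Polygons are closed and nondegenerate. Their edges are the one-dimensional faces in the sense
  of \<^const>\<open>edge_of\<close>, so consecutive edges are never collinear.\<close>

definition convex_polygon :: "(real \<times> real) set \<Rightarrow> bool" where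
  "convex_polygon P \<longleftrightarrow> polytope P \<and> aff_dim P = 2"

definition parallel_to_segment :: "real \<times> real \<Rightarrow> (real \<times> real) set \<Rightarrow> bool" where
  "parallel_to_segment v F \<longleftrightarrow> (\<exists>a b c. F = closed_segment a b \<and> a \<noteq> b \<and> b - a = c *\<^sub>R v)"

definition rotate_vec :: "real \<Rightarrow> real \<times> real \<Rightarrow> real \<times> real" where
  "rotate_vec \<phi> v = (cos \<phi> * fst v - sin \<phi> * snd v, sin \<phi> * fst v + cos \<phi> * snd v)"

end

theory Submission
  imports Defs
begin

text \<open>Cutting the orbit at integer heights reduces the discrepancy, up to an error of 2, to an orbit
  sum of the rotation by \<open>\<alpha>\<^sub>1\<close> over the periodisation of the chord function \<open>f\<close> of \<open>P\<close> in the
  direction of \<open>\<alpha>\<close>. In the coordinates \<open>u = x - \<alpha>\<^sub>1 y\<close> and \<open>t = y\<close> the polygon lies between a minimum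
  and a maximum of affine functions whose slopes are given by the edges, so \<open>f = max 0 g\<close> with \<open>g\<close>
  concave and \<open>K\<close>-Lipschitz, where \<open>K = max |cot \<phi>\<^sub>k - cot \<phi>\<^sub>l| / |\<alpha>|\<^sup>2\<close>.

  Instead of expanding \<open>f\<close> in a Fourier series, sample it on the grid \<open>x + i / q\<close> and replace
  \<open>\<alpha>\<^sub>1\<close> by a fraction \<open>p / q\<close> with \<open>|\<alpha>\<^sub>1 - p / q| \<le> 1 / q\<^sup>2\<close>. The second differences of the samples sum to
  at most \<open>4 K / q\<close> in absolute value, so the \<open>k\<close>-th discrete Fourier coefficient is at most
  \<open>K / (4 k\<^sup>2)\<close> for \<open>k \<le> q / 2\<close>; there also \<open>\<parallel>k \<alpha>\<^sub>1\<parallel> \<le> 3/2 \<parallel>k p / q\<parallel>\<close>, and summing geometric series bounds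
  the orbit sum by \<open>3/8 K \<Sum> 1 / (n\<^sup>2 \<parallel>n \<alpha>\<^sub>1\<parallel>)\<close>. This passes to the limit \<open>q \<rightarrow> \<infinity>\<close>, and
  \<open>3/8 \<le> 4 / \<pi>\<^sup>2 \<le> (N + 1) / \<pi>\<^sup>2\<close> since a polygon has at least three edges.\<close>

section \<open>Nearest integers, second differences and exponential sums\<close>

lemma dist_nearest_int_le: "dist_nearest_int x \<le> \<bar>x - of_int m\<bar>"
  unfolding dist_nearest_int_def by (rule round_diff_minimal)

lemma dist_nearest_int_le_half: "dist_nearest_int x \<le> 1 / 2"
  unfolding dist_nearest_int_def
  using of_int_round_abs_le[of x] by (simp add: abs_minus_commute)

lemma dist_nearest_int_nonneg: "0 \<le> dist_nearest_int x"
  by (simp add: dist_nearest_int_def)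

text \<open>Jordan's inequality: sine is concave on [0, pi/2], so its graph lies above the chord
  through the endpoints.\<close>

lemma sin_ge_chord:
  fixes t :: real
  assumes "0 \<le> t" "t \<le> pi / 2"
  shows "2 * t / pi \<le> sin t"
proof -
  have "concave_on {0..pi/2} sin"
  proof (rule f''_le0_imp_concave)
    show "\<And>x. x \<in> {0..pi/2} \<Longrightarrow> (sin has_real_derivative cos x) (at x)"
      by (auto intro!: derivative_eq_intros)
    show "\<And>x. x \<in> {0..pi/2} \<Longrightarrow> (cos has_real_derivative - sin x) (at x)"
      by (auto intro!: derivative_eq_intros)
    show "\<And>x. x \<in> {0..pi/2} \<Longrightarrow> - sin x \<le> 0"
      using pi_gt_zero by (auto intro!: sin_ge_zero)
  qed auto
  then have "(1 - 2 * t / pi) * sin 0 + (2 * t / pi) * sin (pi/2)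
      \<le> sin ((1 - 2 * t / pi) *\<^sub>R 0 + (2 * t / pi) *\<^sub>R (pi / 2))"
    using assms by (intro concave_onD) (auto simp: field_simps)
  then show ?thesis by simp
qed

text \<open>Since \<open>\<bar>sin (pi * x)\<bar>\<close> is even and has period 1, \<open>x\<close>
  may be replaced by its distance to the nearest integer, where Jordan's inequality applies.\<close>

lemma abs_sin_pi_ge: "2 * dist_nearest_int x \<le> \<bar>sin (pi * x)\<bar>"
proof -
  define y where "y = x - of_int (round x)"
  have y: "\<bar>y\<bar> \<le> 1 / 2"
    using dist_nearest_int_le_half[of x] by (simp add: y_def dist_nearest_int_def)
  have "sin (pi * x) = sin (pi * y + pi * of_int (round x))"
    by (simp add: y_def algebra_simps)
  also have "\<dots> = sin (pi * y) * cos (pi * of_int (round x))"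
    by (simp add: sin_add sin_npi_int)
  finally have "\<bar>sin (pi * x)\<bar> = \<bar>sin (pi * y)\<bar>"
    by (simp add: abs_mult cos_npi_int)
  also have "\<dots> = \<bar>sin (pi * \<bar>y\<bar>)\<bar>"
    by (cases "y \<ge> 0") (auto simp: abs_if[of y])
  also have "\<dots> \<ge> 2 * (pi * \<bar>y\<bar>) / pi"
    using sin_ge_chord[of "pi * \<bar>y\<bar>"] y by (simp add: field_simps)
  finally show ?thesis by (simp add: y_def dist_nearest_int_def)
qed

lemma sum_int_telescope:
  fixes f :: "int \<Rightarrow> 'a::ab_group_add"
  assumes "m \<le> n"
  shows "(\<Sum>i\<in>{m..<n}. f (i + 1) - f i) = f n - f m"
  using assms
proof (induction n rule: int_ge_induct)
  case (step i)
  have "{m..<i + 1} = insert i {m..<i}" using step.hyps by auto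
  then show ?case using step.IH by simp
qed simp

section \<open>Total variation of truncated concave sequences\<close>

text \<open>The sum is the total variation of the increments of \<open>w\<close>. These decrease
  while \<open>g\<close> is positive, so the interior telescopes. Each kink, together with one end
  of the telescoped sum, contributes twice the maximum of two quantities that are at most
  \<open>D\<close>.\<close>

lemma second_difference_sum_le:
  fixes w g :: "int \<Rightarrow> real"
  assumes w: "\<And>i. w i = max 0 (g i)"
    and slope: "\<And>i. \<bar>g (i + 1) - g i\<bar> \<le> D"
    and conc: "\<And>i. g (i + 1) + g (i - 1) \<le> 2 * g i"
    and conn: "\<And>i j k. i \<le> j \<Longrightarrow> j \<le> k \<Longrightarrow> 0 < g i \<Longrightarrow> 0 < g k \<Longrightarrow> 0 < g j"
    and supp: "\<And>i. w i \<noteq> 0 \<Longrightarrow> a \<le> i \<and> i \<le> b"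
  shows "(\<Sum>i=a-1..b+1. \<bar>w (i + 1) - 2 * w i + w (i - 1)\<bar>) \<le> 4 * D"
proof (cases "\<exists>i. 0 < g i")
  case False
  then have "w i = 0" for i using w[of i] by (auto simp: not_less)
  then show ?thesis using slope[of 0] by simp
next
  case True
  define I where "I = {i. 0 < g i}"
  have "I \<subseteq> {a..b}" using supp w by (fastforce simp: I_def)
  then have finI: "finite I" using finite_subset by blast
  have neI: "I \<noteq> {}" using True by (auto simp: I_def)
  define p r where "p = Min I" and "r = Max I"
  have pI: "p \<in> I" and rI: "r \<in> I" using finI neI by (auto simp: p_def r_def)
  then have pr: "p \<le> r" "a \<le> p" "r \<le> b"
    using finI \<open>I \<subseteq> {a..b}\<close> by (auto simp: p_def)
  have pos: "0 < g i" if "p \<le> i" "i \<le> r" for i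
    using conn[OF that] pI rI by (auto simp: I_def)
  have neg: "g i \<le> 0" if "i < p \<or> r < i" for i
  proof (rule ccontr)
    assume "\<not> g i \<le> 0"
    then have "i \<in> I" by (auto simp: I_def)
    then have "p \<le> i" "i \<le> r" using finI by (auto simp: p_def r_def)
    then show False using that by simp
  qed
  have wpos: "w i = g i" if "p \<le> i" "i \<le> r" for i using pos[OF that] w[of i] by simp
  have wneg: "w i = 0" if "i < p \<or> r < i" for i using neg[OF that] w[of i] by simp
  define \<Delta> where "\<Delta> = (\<lambda>i. w (i + 1) - 2 * w i + w (i - 1))"
  \<comment> \<open>\<open>g\<close> is nonpositive one index before \<open>p\<close>, so a single
    increment bounds \<open>w p\<close>; \<open>w r\<close> is bounded likewise from the
    right.\<close>
  have vp: "w p \<le> D" using slope[of "p - 1"] neg[of "p - 1"] wpos[of p] pr by auto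
  have vr: "w r \<le> D" using slope[of r] neg[of "r + 1"] wpos[of r] pr by auto
  have vp0: "0 \<le> w p" "0 \<le> w r" by (auto simp: w)
  have z: "\<Delta> i = 0" if "i < p - 1 \<or> r + 1 < i" for i
    using that by (auto simp: \<Delta>_def wneg)
  have "(\<Sum>i=a-1..b+1. \<bar>\<Delta> i\<bar>) = (\<Sum>i=p-1..r+1. \<bar>\<Delta> i\<bar>)"
    using pr z by (intro sum.mono_neutral_right) auto
  also have "\<dots> \<le> 4 * D"
  proof (cases "p = r")
    case True
    have "{p-1..r+1} = {p-1,p,p+1}" using True by auto
    then show ?thesis using True vp vp0 by (simp add: \<Delta>_def wneg)
  next
    case False
    then have lt: "p < r" using pr by simp
    \<comment> \<open>Only strictly between \<open>p\<close> and \<open>r\<close> do all three terms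
      of the second difference come from \<open>g\<close>; the indices around the kinks are split
      off.\<close>
    have set: "{p-1..r+1} = {p-1,p,r,r+1} \<union> {p+1..<r}" using lt by auto
    have int: "\<bar>\<Delta> i\<bar> = - \<Delta> i" if "i \<in> {p+1..<r}" for i
      using conc[of i] that wpos[of i] wpos[of "i+1"] wpos[of "i-1"] by (auto simp: \<Delta>_def)
    have "(\<Sum>i\<in>{p+1..<r}. \<bar>\<Delta> i\<bar>) = - (\<Sum>i\<in>{p+1..<r}. (w (i + 1) - w (i + 1 - 1)) - (w i - w (i - 1)))"
      unfolding sum_negf[symmetric] by (intro sum.cong refl) (simp only: int, simp add: \<Delta>_def)
    also have "\<dots> = - ((w r - w (r - 1)) - (w (p + 1) - w (p + 1 - 1)))"
      using lt by (subst sum_int_telescope[where f = "\<lambda>i. w i - w (i - 1)"]) auto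
    finally have mid: "(\<Sum>i\<in>{p+1..<r}. \<bar>\<Delta> i\<bar>) = (w (p + 1) - w p) + (w (r - 1) - w r)" by simp
    have "(\<Sum>i=p-1..r+1. \<bar>\<Delta> i\<bar>) =
        (\<Sum>i\<in>{p-1,p,r,r+1}. \<bar>\<Delta> i\<bar>) + (\<Sum>i\<in>{p+1..<r}. \<bar>\<Delta> i\<bar>)"
      unfolding set using lt by (intro sum.union_disjoint) auto
    also have "(\<Sum>i\<in>{p-1,p,r,r+1}. \<bar>\<Delta> i\<bar>) = \<bar>\<Delta> (p-1)\<bar> + \<bar>\<Delta> p\<bar> + \<bar>\<Delta> r\<bar> + \<bar>\<Delta> (r+1)\<bar>"
      using lt by simp
    also have "\<Delta> (p-1) = w p" by (simp add: \<Delta>_def wneg)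
    also have "\<Delta> (r+1) = w r" by (simp add: \<Delta>_def wneg)
    also have "\<Delta> p = w (p+1) - 2 * w p" by (simp add: \<Delta>_def wneg)
    also have "\<Delta> r = w (r-1) - 2 * w r" by (simp add: \<Delta>_def wneg)
    finally show ?thesis
      using mid vp vr vp0 slope[of p] slope[of "r-1"] wpos[of p] wpos[of "p+1"] wpos[of r]
        wpos[of "r-1"] lt by auto
  qed
  finally show ?thesis by (simp add: \<Delta>_def)
qed

section \<open>Discrete Fourier coefficients and exponential sums\<close>

text \<open>Summation by parts: a shift of \<open>w\<close> multiplies its Fourier sum by a
  character, so taking second differences multiplies it by \<open>2 * cos \<theta> - 2\<close>. The
  window grows by one index on both sides so that no boundary terms are left.\<close>

lemma norm_fourier_sum_le:
  fixes w :: "int \<Rightarrow> real"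
  assumes supp: "\<And>i. w i \<noteq> 0 \<Longrightarrow> a \<le> i \<and> i \<le> b"
  shows "4 * (sin (\<theta> / 2))\<^sup>2 * norm (\<Sum>i=a..b. of_real (w i) * cis (- (of_int i * \<theta>)))
    \<le> (\<Sum>i=a-1..b+1. \<bar>w (i + 1) - 2 * w i + w (i - 1)\<bar>)"
proof -
  define c where "c = (\<Sum>i=a..b. of_real (w i) * cis (- (of_int i * \<theta>)))"
  have zero: "w i = 0" if "\<not> (a \<le> i \<and> i \<le> b)" for i using supp that by blast
  have sh: "(\<Sum>i=a-1..b+1. of_real (w (i + j)) * cis (- (of_int i * \<theta>))) = cis (of_int j * \<theta>) * c"
    if j: "\<bar>j\<bar> \<le> 1" for j
  proof -
    have "(\<Sum>i=a-1..b+1. of_real (w (i + j)) * cis (- (of_int i * \<theta>)))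
      = (\<Sum>i=a-1+j..b+1+j. of_real (w i) * cis (- (of_int (i - j) * \<theta>)))"
      by (rule sum.reindex_bij_witness[where i = "\<lambda>i. i - j" and j = "\<lambda>i. i + j"]) auto
    also have "\<dots> = (\<Sum>i=a..b. of_real (w i) * cis (- (of_int (i - j) * \<theta>)))"
      using j by (intro sum.mono_neutral_right) (auto intro!: zero)
    also have "\<dots> = cis (of_int j * \<theta>) * c"
      unfolding c_def sum_distrib_left
      by (intro sum.cong) (auto simp: cis_mult algebra_simps)
    finally show ?thesis .
  qed
  have "(\<Sum>i=a-1..b+1. of_real (w (i + 1) - 2 * w i + w (i - 1)) * cis (- (of_int i * \<theta>)))
    = cis \<theta> * c - 2 * c + cis (- \<theta>) * c"
    using sh[of 1] sh[of 0] sh[of "-1"]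
    by (simp add: algebra_simps sum.distrib sum_subtractf sum_distrib_left[where r = 2, symmetric])
  also have "\<dots> = of_real (2 * cos \<theta> - 2) * c"
    by (simp add: complex_eq_iff algebra_simps)
  also have "2 * cos \<theta> - 2 = - 4 * (sin (\<theta> / 2))\<^sup>2"
    using cos_double_sin[of "\<theta> / 2"] by simp
  finally have "norm (of_real (- 4 * (sin (\<theta> / 2))\<^sup>2) * c) =
     norm (\<Sum>i=a-1..b+1. of_real (w (i + 1) - 2 * w i + w (i - 1)) * cis (- (of_int i * \<theta>)))"
    by simp
  also have "\<dots> \<le> (\<Sum>i=a-1..b+1. \<bar>w (i + 1) - 2 * w i + w (i - 1)\<bar>)"
    by (rule order.trans[OF norm_sum]) (simp add: norm_mult del: of_real_add of_real_diff of_real_mult)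
  finally show ?thesis by (simp add: norm_mult norm_power c_def)
qed

text \<open>In the closed form of the geometric sum the numerator has norm at most 2 and the
  denominator is the chord length \<open>2 * \<bar>sin (\<theta> / 2)\<bar>\<close>, so the bound is
  uniform in \<open>M\<close>.\<close>

lemma norm_geometric_cis_le:
  assumes "sin (\<theta> / 2) \<noteq> 0"
  shows "norm (\<Sum>n<M. cis (real n * \<theta>)) \<le> 1 / \<bar>sin (\<theta> / 2)\<bar>"
proof -
  have nz: "norm (cis \<theta> - 1) = 2 * \<bar>sin (\<theta> / 2)\<bar>"
  proof -
    have "cis \<theta> - 1 = cis (\<theta> / 2) * (cis (\<theta> / 2) - cis (- (\<theta> / 2)))"
      by (simp add: algebra_simps cis_mult)
    also have "cis (\<theta> / 2) - cis (- (\<theta> / 2)) = of_real (2 * sin (\<theta> / 2)) * \<i>"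
      by (simp add: complex_eq_iff)
    finally show ?thesis by (simp add: norm_mult)
  qed
  then have ne: "cis \<theta> \<noteq> 1" using assms by auto
  have "(\<Sum>n<M. cis (real n * \<theta>)) = (\<Sum>n<M. cis \<theta> ^ n)"
    by (simp add: Complex.DeMoivre)
  also have "\<dots> = (cis \<theta> ^ M - 1) / (cis \<theta> - 1)"
    using ne by (rule geometric_sum)
  finally have "norm (\<Sum>n<M. cis (real n * \<theta>)) = norm (cis \<theta> ^ M - 1) / (2 * \<bar>sin (\<theta> / 2)\<bar>)"
    by (simp add: norm_divide nz)
  also have "norm (cis \<theta> ^ M - 1) \<le> 2"
    using norm_triangle_ineq4[of "cis \<theta> ^ M" 1] by (simp add: norm_power)
  finally show ?thesis by (simp add: divide_right_mono)
qed

lemma sum_cis_orthogonality: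
  assumes q: "q > 0"
  shows "(\<Sum>k<q. cis (2 * pi * real k * of_int d / real q)) = (if int q dvd d then of_nat q else 0)"
proof -
  define z where "z = cis (2 * pi * of_int d / real q)"
  have pw: "(\<Sum>k<q. cis (2 * pi * real k * of_int d / real q)) = (\<Sum>k<q. z ^ k)"
    by (simp add: z_def Complex.DeMoivre mult_ac)
  have zq: "z ^ q = 1"
    using q by (simp add: z_def Complex.DeMoivre complex_eq_iff sin_int_2pin cos_int_2pin)
  have iff: "z = 1 \<longleftrightarrow> int q dvd d"
  proof
    assume "z = 1"
    then have "cos (2 * pi * of_int d / real q) = 1" by (simp add: z_def complex_eq_iff)
    then obtain n :: int where "2 * pi * of_int d / real q = of_int n * 2 * pi"
      using cos_one_2pi_int by auto
    then have "real_of_int d = of_int (int q * n)" using q by (simp add: field_simps)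
    then have "d = int q * n" by linarith
    then show "int q dvd d" by simp
  next
    assume "int q dvd d"
    then obtain n where "d = int q * n" by blast
    then have "2 * pi * of_int d / real q = 2 * pi * of_int n" using q by simp
    then show "z = 1" by (simp add: z_def complex_eq_iff sin_int_2pin cos_int_2pin)
  qed
  show ?thesis
  proof (cases "z = 1")
    case True then show ?thesis using iff by (simp add: pw)
  next
    case False then show ?thesis using iff zq by (simp add: pw geometric_sum)
  qed
qed

section \<open>Finite Fourier analysis of a rational rotation\<close>

text \<open>Orthogonality of characters detects the congruence of \<open>i\<close> and
  \<open>n p\<close> modulo \<open>q\<close>. Frequency 0 yields the subtracted mean; every other
  frequency is a Fourier coefficient of \<open>w\<close> times a geometric sum over
  \<open>n\<close>, and both factors have been estimated.\<close>

lemma rotation_sum_le: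
  fixes w :: "int \<Rightarrow> real" and p :: int and q M :: nat
  assumes q: "q > 0" and cop: "coprime p (int q)"
    and supp: "\<And>i. w i \<noteq> 0 \<Longrightarrow> a \<le> i \<and> i \<le> b"
    and D: "(\<Sum>i=a-1..b+1. \<bar>w (i + 1) - 2 * w i + w (i - 1)\<bar>) \<le> 4 * D"
  shows "\<bar>(\<Sum>n<M. \<Sum>i | i \<in> {a..b} \<and> int q dvd (int n * p - i). w i) - real M * (\<Sum>i=a..b. w i) / real q\<bar>
    \<le> (\<Sum>k=1..<q. D / ((sin (pi * (real k / real q)))\<^sup>2 * \<bar>sin (pi * (real k * of_int p / real q))\<bar>)) / real q"
proof -
  define \<theta> where "\<theta> = (\<lambda>k::nat. 2 * pi * real k / real q)"
  define c where "c = (\<lambda>k. \<Sum>i=a..b. of_real (w i) * cis (- (of_int i * \<theta> k)))"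
  define G where "G = (\<lambda>k. \<Sum>n<M. cis (real n * (\<theta> k * of_int p)))"
  have one: "of_real (\<Sum>i | i \<in> {a..b} \<and> int q dvd (int n * p - i). w i)
      = (\<Sum>k<q. c k * cis (real n * (\<theta> k * of_int p))) / of_nat q" for n
  proof -
    have "(\<Sum>k<q. c k * cis (real n * (\<theta> k * of_int p)))
      = (\<Sum>k<q. \<Sum>i=a..b. of_real (w i) * cis (2 * pi * real k * of_int (int n * p - i) / real q))"
      unfolding c_def sum_distrib_right
      by (intro sum.cong) (auto simp: cis_mult \<theta>_def diff_divide_distrib algebra_simps)
    also have "\<dots> = (\<Sum>i=a..b. of_real (w i) *
        (\<Sum>k<q. cis (2 * pi * real k * of_int (int n * p - i) / real q)))"
      unfolding sum_distrib_left by (rule sum.swap)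
    also have "\<dots> = (\<Sum>i=a..b. if int q dvd (int n * p - i) then of_real (w i) * of_nat q else 0)"
      unfolding sum_cis_orthogonality[OF q] by (intro sum.cong) auto
    also have "\<dots> = (\<Sum>i | i \<in> {a..b} \<and> int q dvd (int n * p - i). of_real (w i)) * of_nat q"
      unfolding sum_distrib_right by (subst sum.inter_filter[symmetric]) auto
    finally show ?thesis using q by simp
  qed
  have mean_diff: "of_real (X - real M * Y / real q) = Z / of_nat q"
    if "of_real X = (of_real Y * of_nat M + Z) / of_nat q" for X Y :: real and Z :: complex
    using that by (simp add: add_divide_distrib)
  have c0: "c 0 = of_real (\<Sum>i=a..b. w i)" by (simp add: c_def \<theta>_def)
  have G0: "G 0 = of_nat M" by (simp add: G_def \<theta>_def)
  have "of_real (\<Sum>n<M. \<Sum>i | i \<in> {a..b} \<and> int q dvd (int n * p - i). w i)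
    = (\<Sum>n<M. (\<Sum>k<q. c k * cis (real n * (\<theta> k * of_int p))) / of_nat q)"
    by (simp only: of_real_sum[of _ "{..<M}"] one)
  also have "\<dots> = (\<Sum>n<M. (\<Sum>k<q. c k * cis (real n * (\<theta> k * of_int p)))) / of_nat q"
    by (simp add: sum_divide_distrib)
  also have "(\<Sum>n<M. (\<Sum>k<q. c k * cis (real n * (\<theta> k * of_int p)))) = (\<Sum>k<q. c k * G k)"
    unfolding G_def sum_distrib_left by (rule sum.swap)
  also have "{..<q} = insert 0 {1..<q}" using q by auto
  also have "(\<Sum>k\<in>insert 0 {1..<q}. c k * G k) = c 0 * G 0 + (\<Sum>k=1..<q. c k * G k)"
    by (subst sum.insert) auto
  finally have eq: "of_real (\<Sum>n<M. \<Sum>i | i \<in> {a..b} \<and> int q dvd (int n * p - i). w i)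
      = (c 0 * G 0 + (\<Sum>k=1..<q. c k * G k)) / of_nat q" .
  have "of_real ((\<Sum>n<M. \<Sum>i | i \<in> {a..b} \<and> int q dvd (int n * p - i). w i)
      - real M * (\<Sum>i=a..b. w i) / real q) = (\<Sum>k=1..<q. c k * G k) / of_nat q"
    using eq unfolding c0 G0 by (rule mean_diff)
  then have "\<bar>(\<Sum>n<M. \<Sum>i | i \<in> {a..b} \<and> int q dvd (int n * p - i). w i)
      - real M * (\<Sum>i=a..b. w i) / real q\<bar> = norm ((\<Sum>k=1..<q. c k * G k) / of_nat q)"
    by (simp only: norm_of_real[symmetric, where 'a = complex])
  also have "\<dots> = norm (\<Sum>k=1..<q. c k * G k) / real q" by (simp add: norm_divide)
  also have "norm (\<Sum>k=1..<q. c k * G k) \<le>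
    (\<Sum>k=1..<q. D / ((sin (pi * (real k / real q)))\<^sup>2 * \<bar>sin (pi * (real k * of_int p / real q))\<bar>))"
  proof (rule sum_norm_le)
    fix k assume k: "k \<in> {1..<q}"
    have ne: "sin (pi * (of_int j / real q)) \<noteq> 0" if "\<not> int q dvd j" for j
    proof
      assume "sin (pi * (of_int j / real q)) = 0"
      then obtain i :: int where "pi * (of_int j / real q) = of_int i * pi"
        using sin_zero_iff_int2 by blast
      then have "real_of_int j = of_int (int q * i)" using q by (simp add: field_simps)
      then have "j = int q * i" by linarith
      then show False using that by simp
    qed
    \<comment> \<open>For \<open>0 < k < q\<close> neither \<open>k\<close> nor, by coprimality,
      \<open>k * p\<close> is a multiple of \<open>q\<close>, so both sines are nonzero and may be
      divided by.\<close>
    have nd: "\<not> int q dvd int k" using k zdvd_not_zless[of "int k" "int q"] by auto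
    then have nd2: "\<not> int q dvd int k * p"
      using cop by (simp add: coprime_commute coprime_dvd_mult_left_iff)
    have s1: "sin (pi * (real k / real q)) \<noteq> 0" using ne[OF nd] by simp
    have s2: "sin (pi * (real k * of_int p / real q)) \<noteq> 0" using ne[OF nd2] by simp
    have h1: "\<theta> k / 2 = pi * (real k / real q)" by (simp add: \<theta>_def)
    have h2: "\<theta> k * of_int p / 2 = pi * (real k * of_int p / real q)" by (simp add: \<theta>_def)
    have "4 * (sin (\<theta> k / 2))\<^sup>2 * norm (c k) \<le> 4 * D"
      unfolding c_def using norm_fourier_sum_le[of w a b "\<theta> k", OF supp] D by linarith
    then have c: "norm (c k) \<le> D / (sin (pi * (real k / real q)))\<^sup>2"
      using s1 by (simp add: h1 field_simps)
    have G: "norm (G k) \<le> 1 / \<bar>sin (pi * (real k * of_int p / real q))\<bar>"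
      unfolding G_def by (rule norm_geometric_cis_le[of "\<theta> k * of_int p" M, unfolded h2, OF s2])
    have "norm (c k * G k) \<le> (D / (sin (pi * (real k / real q)))\<^sup>2) * (1 / \<bar>sin (pi * (real k * of_int p / real q))\<bar>)"
      unfolding norm_mult by (intro mult_mono c G order.trans[OF norm_ge_zero c]) auto
    then show "norm (c k * G k) \<le> D / ((sin (pi * (real k / real q)))\<^sup>2 * \<bar>sin (pi * (real k * of_int p / real q))\<bar>)"
      by simp
  qed
  finally show ?thesis using q by (simp add: divide_right_mono)
qed

section \<open>Distance to the nearest integer under rational approximation\<close>

lemma dist_nearest_int_fraction:
  assumes "0 < k" "2 * k \<le> q"
  shows "real k / real q \<le> dist_nearest_int (real k / real q)"
proof -
  define m where "m = round (real k / real q)"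
  have r: "0 < real k / real q" "real k / real q \<le> 1 / 2"
    using assms by (auto simp: field_simps)
  have "\<bar>of_int m - real k / real q\<bar> \<le> 1/2" unfolding m_def by (rule of_int_round_abs_le)
  consider "m \<le> 0" | "m \<ge> 1" by linarith
  then show ?thesis
  proof cases
    case 1
    then have "real_of_int m \<le> 0" by simp
    then show ?thesis using r unfolding dist_nearest_int_def m_def[symmetric] by linarith
  next
    case 2
    then have "real_of_int m \<ge> 1" by simp
    then show ?thesis using r unfolding dist_nearest_int_def m_def[symmetric] by linarith
  qed
qed

lemma dist_nearest_int_ge_inverse:
  assumes "q > 0" "\<not> int q dvd j"
  shows "1 / real q \<le> dist_nearest_int (of_int j / real q)"
proof -
  define m where "m = round (of_int j / real q)"
  have "j \<noteq> m * int q" using assms by auto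
  then have "1 \<le> \<bar>j - m * int q\<bar>" by linarith
  then have "1 \<le> \<bar>real_of_int j - of_int m * real q\<bar>"
    by (metis of_int_1_le_iff of_int_abs of_int_diff of_int_mult of_int_of_nat_eq)
  then have "1 / real q \<le> \<bar>real_of_int j - of_int m * real q\<bar> / real q"
    using assms by (simp add: divide_right_mono)
  also have "\<dots> = \<bar>(real_of_int j - of_int m * real q) / real q\<bar>" by simp
  also have "(real_of_int j - of_int m * real q) / real q = of_int j / real q - of_int m"
    using assms by (simp add: field_simps)
  finally show ?thesis by (simp add: dist_nearest_int_def m_def)
qed

lemma dist_nearest_int_Lipschitz: "dist_nearest_int x \<le> dist_nearest_int y + \<bar>x - y\<bar>"
  using dist_nearest_int_le[of x "round y"] by (simp add: dist_nearest_int_def)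

text \<open>Replacing \<open>\<alpha>\<close> by \<open>p / q\<close> moves the \<open>k\<close>-th
  multiple by at most \<open>k / q\<close> times \<open>1 / q\<close>, hence by at most
  \<open>1 / (2 q)\<close>. As \<open>k p / q\<close> is no integer, its own distance is at least
  \<open>1 / q\<close>, so the perturbation costs at most half of that distance.\<close>

lemma dist_nearest_int_approx:
  assumes q: "q > 0" and k: "0 < k" "2 * k \<le> q" and cop: "coprime p (int q)"
    and approx: "\<bar>real q * \<alpha> - of_int p\<bar> \<le> 1 / real q"
  shows "dist_nearest_int (real k * \<alpha>) \<le> 3 / 2 * dist_nearest_int (real k * of_int p / real q)"
proof -
  have "\<not> int q dvd int k" using k zdvd_not_zless[of "int k" "int q"] by auto
  then have "\<not> int q dvd int k * p"
    using cop by (simp add: coprime_commute coprime_dvd_mult_left_iff)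
  from dist_nearest_int_ge_inverse[OF q this]
  have lower: "1 / real q \<le> dist_nearest_int (real k * of_int p / real q)" by simp
  have "real k * \<alpha> - real k * of_int p / real q = real k / real q * (real q * \<alpha> - of_int p)"
    using q by (simp add: field_simps)
  then have "\<bar>real k * \<alpha> - real k * of_int p / real q\<bar> = real k / real q * \<bar>real q * \<alpha> - of_int p\<bar>"
    by (simp add: abs_mult)
  also have "\<dots> \<le> 1 / 2 * (1 / real q)"
    using k q by (intro mult_mono approx) (auto simp: field_simps)
  finally show ?thesis
    using dist_nearest_int_Lipschitz[of "real k * \<alpha>" "real k * of_int p / real q"] lower by linarith
qed

lemma dist_nearest_int_uminus: "dist_nearest_int (- x) = dist_nearest_int x"
proof -
  have "dist_nearest_int (- y) \<le> dist_nearest_int y" for y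
    using dist_nearest_int_le[of "- y" "- round y"] by (simp add: dist_nearest_int_def)
  from this[of x] this[of "- x"] show ?thesis by simp
qed

lemma dist_nearest_int_add_int: "dist_nearest_int (x + of_int m) = dist_nearest_int x"
proof -
  have "dist_nearest_int (y + of_int j) \<le> dist_nearest_int y" for y j
    using dist_nearest_int_le[of "y + of_int j" "round y + j"] by (simp add: dist_nearest_int_def)
  from this[of x m] this[of "x + of_int m" "- m"] show ?thesis by simp
qed

lemma dist_nearest_int_pos:
  assumes "\<alpha> \<notin> \<rat>" "k > 0"
  shows "0 < dist_nearest_int (real k * \<alpha>)"
proof (rule ccontr)
  assume "\<not> ?thesis"
  then have "real k * \<alpha> = of_int (round (real k * \<alpha>))"
    by (simp add: dist_nearest_int_def)
  then have "\<alpha> = of_int (round (real k * \<alpha>)) / of_nat k"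
    using assms(2) by (simp add: field_simps)
  then show False using assms(1) by (metis Rats_divide Rats_of_int Rats_of_nat)
qed

text \<open>The summand is symmetric under \<open>k \<mapsto> q - k\<close>, so only \<open>k \<le> q / 2\<close> matters, where
  \<open>\<parallel>k / q\<parallel> = k / q\<close>.\<close>

lemma sine_sum_le:
  assumes q: "q > 0" and cop: "coprime p (int q)"
    and approx: "\<bar>real q * \<alpha> - of_int p\<bar> \<le> 1 / real q"
    and irr: "\<alpha> \<notin> \<rat>" and K: "0 \<le> K"
    and S: "\<And>n. (\<Sum>k<n. 1 / ((real (Suc k))\<^sup>2 * dist_nearest_int (real (Suc k) * \<alpha>))) \<le> S"
  shows "(\<Sum>k=1..<q. (K / real q) / ((sin (pi * (real k / real q)))\<^sup>2 * \<bar>sin (pi * (real k * of_int p / real q))\<bar>)) / real q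
    \<le> 3 / 8 * K * S"
proof -
  define d where "d = dist_nearest_int"
  \<comment> \<open>The 8 is \<open>2 ^ 3\<close>: each of the three sine factors is bounded below
    by twice a nearest-integer distance.\<close>
  define T where "T = (\<lambda>k::nat. K / (8 * (real q)\<^sup>2 * ((d (real k / real q))\<^sup>2 * d (real k * of_int p / real q))))"
  define t where "t = (\<lambda>k::nat. 1 / ((real k)\<^sup>2 * d (real k * \<alpha>)))"
  have dpos: "0 < d (of_int j / real q)" if "\<not> int q dvd j" for j
  proof -
    have "0 < 1 / real q" using q by simp
    then show ?thesis using dist_nearest_int_ge_inverse[OF q that] unfolding d_def by linarith
  qed
  have nd: "\<not> int q dvd int k" "\<not> int q dvd int k * p" if "0 < k" "k < q" for k
  proof -
    show "\<not> int q dvd int k" using that zdvd_not_zless[of "int k" "int q"] by auto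
    then show "\<not> int q dvd int k * p"
      using cop by (simp add: coprime_commute coprime_dvd_mult_left_iff)
  qed
  have d1: "0 < d (real k / real q)" and d2: "0 < d (real k * of_int p / real q)"
    if "0 < k" "k < q" for k
    using dpos[OF nd(1)[OF that]] dpos[OF nd(2)[OF that]] by simp_all
  have step1: "(K / real q) / ((sin (pi * (real k / real q)))\<^sup>2 * \<bar>sin (pi * (real k * of_int p / real q))\<bar>) / real q
     \<le> T k" if k: "k \<in> {1..<q}" for k
  proof -
    have e1: "0 < d (real k / real q)" and e2: "0 < d (real k * of_int p / real q)"
      using k d1[of k] d2[of k] by auto
    have "(2 * d (real k / real q))\<^sup>2 \<le> \<bar>sin (pi * (real k / real q))\<bar>\<^sup>2"
      unfolding d_def by (intro power_mono abs_sin_pi_ge) (simp add: dist_nearest_int_nonneg)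
    then have s1: "(2 * d (real k / real q))\<^sup>2 \<le> (sin (pi * (real k / real q)))\<^sup>2" by simp
    have s2: "2 * d (real k * of_int p / real q) \<le> \<bar>sin (pi * (real k * of_int p / real q))\<bar>"
      unfolding d_def by (rule abs_sin_pi_ge)
    have s0: "0 < (sin (pi * (real k / real q)))\<^sup>2" "0 < \<bar>sin (pi * (real k * of_int p / real q))\<bar>"
      using s1 s2 e1 e2 by (auto intro!: less_le_trans[OF _ s1])
    have "K / ((real q)\<^sup>2 * ((sin (pi * (real k / real q)))\<^sup>2 * \<bar>sin (pi * (real k * of_int p / real q))\<bar>))
      \<le> K / ((real q)\<^sup>2 * ((2 * d (real k / real q))\<^sup>2 * (2 * d (real k * of_int p / real q))))"
      using s0 s1 s2 e1 e2 q K by (intro divide_left_mono mult_left_mono mult_mono mult_pos_pos) simp_all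
    also have "\<dots> = T k" by (simp add: T_def power2_eq_square mult_ac)
    finally show ?thesis by (simp add: power2_eq_square mult_ac)
  qed
  have Tsym: "T (q - k) = T k" if k: "k \<in> {1..<q}" for k
  proof -
    have a: "real (q - k) / real q = - (real k / real q) + of_int 1"
      using k q by (simp add: field_simps of_nat_diff)
    have b: "real (q - k) * of_int p / real q = - (real k * of_int p / real q) + of_int p"
      using k q by (simp add: field_simps of_nat_diff)
    have "d (real (q - k) / real q) = d (real k / real q)"
      unfolding a d_def dist_nearest_int_add_int by (rule dist_nearest_int_uminus)
    moreover have "d (real (q - k) * of_int p / real q) = d (real k * of_int p / real q)"
      unfolding b d_def dist_nearest_int_add_int by (rule dist_nearest_int_uminus)
    ultimately show ?thesis by (simp add: T_def)
  qed
  have T0: "0 \<le> T k" for k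
    unfolding T_def d_def by (intro divide_nonneg_nonneg mult_nonneg_nonneg K) (auto simp: dist_nearest_int_nonneg)
  define H where "H = {k. 0 < k \<and> 2 * k \<le> q \<and> k < q}"
  have finH: "finite H" unfolding H_def by (rule finite_subset[of _ "{..<q}"]) auto
  \<comment> \<open>On \<open>H\<close> the first distance is at least \<open>k / q\<close>, which
    cancels \<open>(real q)\<^sup>2\<close>, and the second loses a factor 2/3; hence 1/8 times 3/2
    gives 3/16.\<close>
  have Tt: "T k \<le> 3 / 16 * K * t k" if k: "k \<in> H" for k
  proof -
    have k': "0 < k" "2 * k \<le> q" "k < q" using k by (auto simp: H_def)
    have e0: "0 < d (real k * \<alpha>)" unfolding d_def by (rule dist_nearest_int_pos[OF irr k'(1)])
    have e1: "real k / real q \<le> d (real k / real q)"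
      unfolding d_def by (rule dist_nearest_int_fraction[OF k'(1,2)])
    have e2: "2 / 3 * d (real k * \<alpha>) \<le> d (real k * of_int p / real q)"
      using dist_nearest_int_approx[OF q k'(1,2) cop approx] by (simp add: d_def)
    have "T k \<le> K / (8 * (real q)\<^sup>2 * ((real k / real q)\<^sup>2 * (2 / 3 * d (real k * \<alpha>))))"
      unfolding T_def using e0 e1 e2 q k' K d1[OF k'(1,3)] d2[OF k'(1,3)]
      by (intro divide_left_mono mult_left_mono mult_mono mult_pos_pos power_mono) auto
    also have "\<dots> = 3 / 16 * K * t k"
      using q k'(1) e0 by (simp add: t_def field_simps)
    finally show ?thesis .
  qed
  have "(\<Sum>k=1..<q. (K / real q) / ((sin (pi * (real k / real q)))\<^sup>2 * \<bar>sin (pi * (real k * of_int p / real q))\<bar>)) / real q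
     \<le> (\<Sum>k=1..<q. T k)"
    unfolding sum_divide_distrib by (intro sum_mono step1)
  also have "\<dots> \<le> (\<Sum>k\<in>H \<union> (\<lambda>k. q - k) ` H. T k)"
  proof (rule sum_mono2)
    show "{1..<q} \<subseteq> H \<union> (\<lambda>k. q - k) ` H"
    proof
      fix k assume k: "k \<in> {1..<q}"
      show "k \<in> H \<union> (\<lambda>k. q - k) ` H"
      proof (cases "2 * k \<le> q")
        case True then show ?thesis using k by (auto simp: H_def)
      next
        case False
        then have "q - k \<in> H" "k = q - (q - k)" using k by (auto simp: H_def)
        then show ?thesis by blast
      qed
    qed
  qed (use finH T0 in auto)
  \<comment> \<open>For even \<open>q\<close> the midpoint \<open>q / 2\<close> belongs to both
    halves; counting it twice is harmless because \<open>T\<close> is nonnegative.\<close>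
  also have "\<dots> \<le> (\<Sum>k\<in>H. T k) + (\<Sum>k\<in>(\<lambda>k. q - k) ` H. T k)"
    using sum.union_inter[OF finH, of "(\<lambda>k. q - k) ` H" T] finH
      sum_nonneg[of "H \<inter> (\<lambda>k. q - k) ` H" T] T0 by simp
  also have "(\<Sum>k\<in>(\<lambda>k. q - k) ` H. T k) = (\<Sum>k\<in>H. T (q - k))"
    by (subst sum.reindex) (auto simp: inj_on_def H_def)
  also have "\<dots> = (\<Sum>k\<in>H. T k)"
    by (intro sum.cong refl Tsym) (auto simp: H_def)
  also have "(\<Sum>k\<in>H. T k) + (\<Sum>k\<in>H. T k) \<le> 2 * (\<Sum>k\<in>H. 3 / 16 * K * t k)"
    using sum_mono[OF Tt, of H "\<lambda>k. k"] by simp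
  also have "\<dots> = 3 / 8 * K * (\<Sum>k\<in>H. t k)" by (simp add: sum_distrib_left mult.assoc)
  also have "\<dots> \<le> 3 / 8 * K * (\<Sum>k\<in>Suc ` {..<q}. t k)"
  proof (intro mult_left_mono sum_mono2)
    show "H \<subseteq> Suc ` {..<q}"
    proof
      fix k assume "k \<in> H"
      then have "k = Suc (k - 1)" "k - 1 \<in> {..<q}" by (auto simp: H_def)
      then show "k \<in> Suc ` {..<q}" by (rule image_eqI)
    qed
    show "0 \<le> t k" for k by (simp add: t_def d_def dist_nearest_int_nonneg)
  qed (use K in auto)
  also have "(\<Sum>k\<in>Suc ` {..<q}. t k) = (\<Sum>k<q. t (Suc k))" by (simp add: sum.reindex)
  also have "3 / 8 * K * (\<Sum>k<q. t (Suc k)) \<le> 3 / 8 * K * S"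
    using S[of q] K unfolding t_def d_def by (intro mult_left_mono) auto
  finally show ?thesis .
qed

section \<open>Orbit sums of concave functions\<close>

text \<open>Equivalently, \<open>g\<close> is concave and \<open>K\<close>-Lipschitz.\<close>

definition supporting_slopes :: "real \<Rightarrow> (real \<Rightarrow> real) \<Rightarrow> bool" where
  "supporting_slopes K g \<longleftrightarrow> (\<forall>u. \<exists>s. \<bar>s\<bar> \<le> K \<and> (\<forall>v. g v \<le> g u + s * (v - u)))"

lemma supporting_slopes_Lipschitz:
  assumes "supporting_slopes K g"
  shows "\<bar>g v - g u\<bar> \<le> K * \<bar>v - u\<bar>"
proof -
  have *: "g b - g a \<le> K * \<bar>b - a\<bar>" for a b
  proof -
    obtain s where s: "\<bar>s\<bar> \<le> K" "\<And>v. g v \<le> g a + s * (v - a)"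
      using assms unfolding supporting_slopes_def by blast
    have "s * (b - a) \<le> \<bar>s\<bar> * \<bar>b - a\<bar>" by (metis abs_ge_self abs_mult)
    also have "\<dots> \<le> K * \<bar>b - a\<bar>" using s(1) by (rule mult_right_mono) simp
    finally show ?thesis using s(2)[of b] by linarith
  qed
  show ?thesis using *[of u v] *[of v u] by (simp add: abs_minus_commute abs_le_iff)
qed

lemma supporting_slopes_midpoint:
  assumes "supporting_slopes K g"
  shows "g (u + h) + g (u - h) \<le> 2 * g u"
proof -
  obtain s where "\<And>v. g v \<le> g u + s * (v - u)"
    using assms unfolding supporting_slopes_def by blast
  from this[of "u + h"] this[of "u - h"] show ?thesis by simp
qed

text \<open>The supporting line at \<open>u\<close> does not rise towards one of the two endpoints;
  there its value is at most \<open>g u\<close> and still dominates a positive value of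
  \<open>g\<close>.\<close>

lemma supporting_slopes_pos_between:
  assumes "supporting_slopes K g" "a \<le> u" "u \<le> b" "0 < g a" "0 < g b"
  shows "0 < g u"
proof -
  obtain s where s: "\<And>v. g v \<le> g u + s * (v - u)"
    using assms unfolding supporting_slopes_def by blast
  show ?thesis
  proof (cases "s \<ge> 0")
    case True
    then have "s * (a - u) \<le> 0" using assms by (simp add: mult_nonneg_nonpos)
    then show ?thesis using s[of a] assms by linarith
  next
    case False
    then have "s * (b - u) \<le> 0" using assms by (simp add: mult_nonpos_nonneg)
    then show ?thesis using s[of b] assms by linarith
  qed
qed

section \<open>Riemann sums and the passage from rational to irrational rotations\<close>

text \<open>On a cell of length \<open>h\<close> the function stays within \<open>K * h\<close> of
  its value at the left endpoint, so each cell errs by at most \<open>K * h\<^sup>2\<close>.\<close>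

lemma Riemann_sum_error:
  fixes f :: "real \<Rightarrow> real"
  assumes lip: "\<And>u v. \<bar>f v - f u\<bar> \<le> K * \<bar>v - u\<bar>" and h: "h \<ge> 0"
  shows "\<bar>integral {c..c + real n * h} f - h * (\<Sum>i<n. f (c + real i * h))\<bar> \<le> real n * (K * h\<^sup>2)"
proof -
  have K: "0 \<le> K" using lip[of 1 0] by simp
  have "K-lipschitz_on UNIV f"
    using lip K by (intro lipschitz_onI) (auto simp: dist_real_def)
  then have cont: "continuous_on A f" for A
    using lipschitz_on_continuous_on continuous_on_subset by blast
  show ?thesis
  proof (induction n)
    case (Suc n)
    define u where "u = c + real n * h"
    have cell: "\<bar>integral {u..u + h} f - h * f u\<bar> \<le> K * h\<^sup>2"
    proof -
      have "((\<lambda>v. f v - f u) has_integral (integral {u..u + h} f - h * f u)) {u..u + h}"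
        using h by (intro has_integral_diff integrable_integral integrable_continuous_real cont)
          (use has_integral_const_real[of "f u" u "u + h"] h in simp)
      moreover have "norm (f v - f u) \<le> K * h" if "v \<in> {u..u + h}" for v
      proof -
        have "K * \<bar>v - u\<bar> \<le> K * h" using that K by (intro mult_left_mono) auto
        then show ?thesis using lip[of v u] by simp
      qed
      ultimately have "norm (integral {u..u + h} f - h * f u) \<le> K * h * measure lborel {u..u + h}"
        using K h by (intro has_integral_bound_real[where S = "{}" and f = "\<lambda>v. f v - f u"]) auto
      then show ?thesis using h by (simp add: power2_eq_square mult_ac)
    qed
    have "integral {c..c + real (Suc n) * h} f = integral {c..u} f + integral {u..u + h} f"
      unfolding u_def using h
      by (subst Henstock_Kurzweil_Integration.integral_combine)
         (auto intro!: integrable_continuous_real cont simp: algebra_simps)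
    then show ?case using Suc cell by (simp add: u_def algebra_simps)
  qed simp
qed

text \<open>Dirichlet's theorem: infinitely many reduced fractions approximate an irrational number
  to within the inverse square of the denominator, so the denominator can exceed any
  \<open>N\<close>.\<close>

lemma approximating_fraction:
  fixes \<alpha> :: real
  assumes "\<alpha> \<notin> \<rat>"
  obtains p :: int and q :: nat where "q > N" "coprime p (int q)" "\<bar>real q * \<alpha> - of_int p\<bar> \<le> 1 / real q"
proof -
  have "infinite (approx_set \<alpha>)" using assms rational_iff_finite_approx_set by blast
  then obtain h k where hk: "(h, k) \<in> approx_set \<alpha>" "k > int N"
    using infinite_approx_set by blast
  then have k: "k > 0" "coprime h k" "\<bar>\<alpha> - of_int h / of_int k\<bar> < 1 / (of_int k)\<^sup>2"
    by (auto simp: approx_set_def)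
  define q where "q = nat k"
  have q: "int q = k" "real_of_int k = real q" "q > 0" using k(1) by (auto simp: q_def)
  have "real q * \<alpha> - of_int h = real q * (\<alpha> - of_int h / real q)"
    using q(3) by (simp add: right_diff_distrib)
  then have "\<bar>real q * \<alpha> - of_int h\<bar> = \<bar>real q * (\<alpha> - of_int h / real q)\<bar>" by (simp only:)
  also have "\<dots> = real q * \<bar>\<alpha> - of_int h / real q\<bar>" by (simp add: abs_mult)
  also have "\<dots> \<le> real q * (1 / (real q)\<^sup>2)" using k(3) q(2) by (intro mult_left_mono) auto
  also have "\<dots> = 1 / real q" by (simp add: power2_eq_square)
  finally show thesis using that[of q h] k(2) q(1) hk(2) by simp
qed

lemma abs_diff_le_trans:
  fixes a :: real
  assumes "\<bar>a - b\<bar> \<le> x" "\<bar>b - c\<bar> \<le> y"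
  shows "\<bar>a - c\<bar> \<le> x + y"
  using assms by linarith

text \<open>On the grid of spacing \<open>1 / q\<close> the points \<open>x + n p / q + m\<close>
  are those whose index is congruent to \<open>n p\<close> modulo \<open>q\<close>, so the finite
  Fourier bound applies to the samples, with slope \<open>K / q\<close> per step. The last term is
  the error of replacing the integral by the grid mean.\<close>

lemma rational_orbit_sum_le:
  fixes f g :: "real \<Rightarrow> real" and M q :: nat and R p :: int
  assumes f: "\<And>u. f u = max 0 (g u)" and g: "supporting_slopes K g"
    and supp: "\<And>u. f u \<noteq> 0 \<Longrightarrow> \<bar>u\<bar> \<le> 1"
    and irr: "\<alpha> \<notin> \<rat>" and \<alpha>: "\<bar>\<alpha>\<bar> \<le> 1"
    and S: "\<And>n. (\<Sum>k<n. 1 / ((real (Suc k))\<^sup>2 * dist_nearest_int (real (Suc k) * \<alpha>))) \<le> S"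
    and R: "\<bar>x\<bar> + 2 * real M + 2 \<le> of_int R"
    and q: "q > 0" and cop: "coprime p (int q)"
    and approx: "\<bar>real q * \<alpha> - of_int p\<bar> \<le> 1 / real q"
  shows "\<bar>(\<Sum>n<M. \<Sum>m=-R..R. f (x + real n * (of_int p / real q) + of_int m)) - real M * integral UNIV f\<bar>
    \<le> 3 / 8 * K * S + real M * (2 * of_int R * K / real q)"
proof -
  define w where "w = (\<lambda>i::int. f (x + of_int i / real q))"
  define b where "b = int q * R"
  have K: "0 \<le> K" using supporting_slopes_Lipschitz[OF g, of 1 0] by simp
  have R0: "0 < R" using R by linarith
  have lip: "\<bar>f v - f u\<bar> \<le> K * \<bar>v - u\<bar>" for u v
    using supporting_slopes_Lipschitz[OF g, of v u] unfolding f by linarith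
  have wsupp: "- b < i \<and> i < b" if "w i \<noteq> 0" for i
  proof -
    have "\<bar>x + of_int i / real q\<bar> \<le> 1" using supp that by (simp add: w_def)
    then have "\<bar>of_int i / real q\<bar> < of_int R" using R by linarith
    then have "\<bar>real_of_int i\<bar> < real q * of_int R" using q by (simp add: field_simps)
    then have "\<bar>real_of_int i\<bar> < of_int b" by (simp add: b_def)
    then show ?thesis by linarith
  qed
  have D: "(\<Sum>i=-b-1..b+1. \<bar>w (i + 1) - 2 * w i + w (i - 1)\<bar>) \<le> 4 * (K / real q)"
  proof (rule second_difference_sum_le[where g = "\<lambda>i. g (x + of_int i / real q)"])
    show "w i = max 0 (g (x + of_int i / real q))" for i by (simp add: w_def f)
    show "\<bar>g (x + of_int (i + 1) / real q) - g (x + of_int i / real q)\<bar> \<le> K / real q" for i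
      using supporting_slopes_Lipschitz[OF g, of "x + of_int (i + 1) / real q" "x + of_int i / real q"] q
      by (simp add: add_divide_distrib)
    show "g (x + of_int (i + 1) / real q) + g (x + of_int (i - 1) / real q) \<le> 2 * g (x + of_int i / real q)" for i
      using supporting_slopes_midpoint[OF g, of "x + of_int i / real q" "1 / real q"]
      by (simp add: add_divide_distrib diff_divide_distrib algebra_simps)
    show "0 < g (x + of_int j / real q)"
      if "i \<le> j" "j \<le> k" "0 < g (x + of_int i / real q)" "0 < g (x + of_int k / real q)" for i j k
      by (rule supporting_slopes_pos_between[OF g _ _ that(3,4)]) (use that q in \<open>auto simp: divide_right_mono\<close>)
    show "- b \<le> i \<and> i \<le> b" if "w i \<noteq> 0" for i using wsupp[OF that] by simp
  qed
  \<comment> \<open>This accounts for \<open>2 * real M\<close> in the bound on \<open>R\<close>: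
    fewer than \<open>M\<close> steps of \<open>p / q\<close> move the orbit by no more than that,
    so no translate meeting the support is cut off.\<close>
  have pq: "\<bar>of_int p / real q\<bar> \<le> 2"
  proof -
    have "\<bar>real_of_int p\<bar> \<le> \<bar>real q * \<alpha>\<bar> + 1 / real q" using approx by linarith
    also have "\<dots> \<le> real q + real q"
    proof (intro add_mono)
      show "\<bar>real q * \<alpha>\<bar> \<le> real q" using \<alpha> by (simp add: abs_mult mult_left_le)
      have "1 / real q \<le> 1" using q by simp
      then show "1 / real q \<le> real q" using q by linarith
    qed
    finally show ?thesis using q by (simp add: field_simps)
  qed
  \<comment> \<open>Setting \<open>i = n p + m q\<close> identifies the residue class with the
    integer translates. The two index windows need not correspond, but unmatched terms vanish, so
    only nonzero terms are reindexed.\<close>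
  have inner: "(\<Sum>i | i \<in> {-b..b} \<and> int q dvd (int n * p - i). w i)
    = (\<Sum>m=-R..R. f (x + real n * (of_int p / real q) + of_int m))" if n: "n < M" for n
  proof -
    let ?A = "{i. i \<in> {-b..b} \<and> int q dvd (int n * p - i)}"
    let ?F = "\<lambda>m. f (x + real n * (of_int p / real q) + of_int m)"
    have val: "w (int n * p + m * int q) = ?F m" for m
      using q by (simp add: w_def add_divide_distrib algebra_simps)
    have div: "int n * p + (i - int n * p) div int q * int q = i" if "int q dvd (int n * p - i)" for i
    proof -
      have "int q dvd i - int n * p" using that by (simp add: dvd_diff_commute)
      then show ?thesis by simp
    qed
    have bnd: "\<bar>m\<bar> \<le> R" if "?F m \<noteq> 0" for m
    proof -
      define y where "y = real n * (of_int p / real q)"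
      have "\<bar>y\<bar> \<le> real M * 2"
        unfolding abs_mult y_def using n pq by (intro mult_mono) auto
      moreover have "\<bar>x + y + of_int m\<bar> \<le> 1" unfolding y_def using supp that by blast
      ultimately have "\<bar>real_of_int m\<bar> \<le> of_int R" using R by linarith
      then show ?thesis by linarith
    qed
    show ?thesis
    proof (rule sum.reindex_bij_witness_not_neutral[where
        S' = "{i \<in> ?A. w i = 0}" and T' = "{m \<in> {-R..R}. ?F m = 0}"
        and i = "\<lambda>m. int n * p + m * int q" and j = "\<lambda>i. (i - int n * p) div int q"])
      fix i assume i: "i \<in> ?A - {i \<in> ?A. w i = 0}"
      then have d: "int n * p + (i - int n * p) div int q * int q = i" using div by blast
      then show "int n * p + (i - int n * p) div int q * int q = i" .
      have "?F ((i - int n * p) div int q) = w i" using val[of "(i - int n * p) div int q"] d by simp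
      then have "?F ((i - int n * p) div int q) \<noteq> 0" using i by auto
      then show "(i - int n * p) div int q \<in> {-R..R} - {m \<in> {-R..R}. ?F m = 0}"
        using bnd[of "(i - int n * p) div int q"] by auto
    next
      fix m assume m: "m \<in> {-R..R} - {m \<in> {-R..R}. ?F m = 0}"
      show "(int n * p + m * int q - int n * p) div int q = m" using q by simp
      have "w (int n * p + m * int q) \<noteq> 0" using m val by auto
      then show "int n * p + m * int q \<in> ?A - {i \<in> ?A. w i = 0}"
        using wsupp[of "int n * p + m * int q"] by auto
    next
      fix i assume "i \<in> ?A"
      then show "?F ((i - int n * p) div int q) = w i"
        using val[of "(i - int n * p) div int q"] div[of i] by auto
    qed (auto intro: finite_subset[of _ "{-b..b}"] finite_subset[of _ "{-R..R}"])
  qed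
  have rot: "\<bar>(\<Sum>n<M. \<Sum>m=-R..R. f (x + real n * (of_int p / real q) + of_int m))
      - real M * (\<Sum>i=-b..b. w i) / real q\<bar> \<le> 3 / 8 * K * S"
  proof -
    have "w i \<noteq> 0 \<Longrightarrow> - b \<le> i \<and> i \<le> b" for i using wsupp[of i] by simp
    from rotation_sum_le[OF q cop this D, of M]
    have "\<bar>(\<Sum>n<M. \<Sum>i | i \<in> {-b..b} \<and> int q dvd (int n * p - i). w i)
        - real M * (\<Sum>i=-b..b. w i) / real q\<bar> \<le> 3 / 8 * K * S"
      using sine_sum_le[OF q cop approx irr K S] by (rule order.trans)
    moreover have "(\<Sum>n<M. \<Sum>i | i \<in> {-b..b} \<and> int q dvd (int n * p - i). w i)
        = (\<Sum>n<M. \<Sum>m=-R..R. f (x + real n * (of_int p / real q) + of_int m))"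
      by (rule sum.cong) (simp_all only: inner lessThan_iff)
    ultimately show ?thesis by (simp only:)
  qed
  have riem: "\<bar>integral UNIV f - (\<Sum>i=-b..b. w i) / real q\<bar> \<le> 2 * of_int R * K / real q"
  proof -
    define c where "c = x - of_int R"
    define n where "n = nat (2 * b)"
    have b0: "0 < b" using R0 q by (simp add: b_def)
    have nr: "real n = 2 * real q * of_int R" using b0 by (simp add: n_def b_def)
    then have nh: "c + real n * (1 / real q) = x + of_int R" using q by (simp add: c_def)
    have "integral UNIV f = integral UNIV (\<lambda>u. if u \<in> {c..x + of_int R} then f u else 0)"
    proof (rule integral_cong)
      fix u
      show "f u = (if u \<in> {c..x + of_int R} then f u else 0)"
      proof (cases "f u = 0")
        case False
        then have "\<bar>u\<bar> \<le> 1" by (rule supp)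
        then have "u \<in> {c..x + of_int R}" using R by (auto simp: c_def)
        then show ?thesis by simp
      qed simp
    qed
    also have "\<dots> = integral {c..x + of_int R} f" by (rule integral_restrict_UNIV)
    finally have int: "integral UNIV f = integral {c..c + real n * (1 / real q)} f" by (simp only: nh)
    \<comment> \<open>\<open>wsupp\<close> is strict, so the last index may be dropped. What remains
      are the left endpoints of \<open>2 * b\<close> cells that fill the window of radius
      \<open>R\<close> about \<open>x\<close>.\<close>
    have "w i = 0" if "i \<in> {-b..b} - {-b..<b}" for i using that wsupp[of i] by fastforce
    then have "(\<Sum>i=-b..b. w i) = (\<Sum>i\<in>{-b..<b}. w i)"
      by (intro sum.mono_neutral_right) auto
    also have "\<dots> = (\<Sum>i<n. f (c + real i * (1 / real q)))"
    proof (rule sum.reindex_bij_witness[where i = "\<lambda>i. int i - b" and j = "\<lambda>i. nat (i + b)"])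
      fix i assume "i \<in> {-b..<b}"
      then have "real (nat (i + b)) = of_int i + of_int b" by simp
      moreover have "of_int b / real q = of_int R" using q by (simp add: b_def)
      ultimately show "f (c + real (nat (i + b)) * (1 / real q)) = w i"
        by (simp add: w_def c_def add_divide_distrib)
    qed (auto simp: n_def)
    finally have "\<bar>integral UNIV f - (\<Sum>i=-b..b. w i) / real q\<bar> \<le> real n * (K * (1 / real q)\<^sup>2)"
      using Riemann_sum_error[of f K "1 / real q" c n, OF lip] int by simp
    also have "\<dots> = 2 * of_int R * K / real q" using q by (simp add: nr power2_eq_square)
    finally show ?thesis .
  qed
  have "\<bar>real M * ((\<Sum>i=-b..b. w i) / real q) - real M * integral UNIV f\<bar> \<le> real M * (2 * of_int R * K / real q)"
    unfolding right_diff_distrib[symmetric] abs_mult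
    using mult_left_mono[OF riem, of "real M"] by (simp add: abs_minus_commute)
  then have "\<bar>real M * (\<Sum>i=-b..b. w i) / real q - real M * integral UNIV f\<bar> \<le> real M * (2 * of_int R * K / real q)"
    by (simp only: times_divide_eq_right)
  with rot show ?thesis by (rule abs_diff_le_trans)
qed

text \<open>The main term does not depend on \<open>q\<close> and the Riemann error is of order
  \<open>1 / q\<close>. Along fractions with growing denominators that tend to
  \<open>\<alpha>\<close> the finite orbit sum converges, because \<open>f\<close> is
  continuous.\<close>

lemma orbit_sum_le:
  fixes f g :: "real \<Rightarrow> real" and M :: nat and R :: int
  assumes f: "\<And>u. f u = max 0 (g u)" and g: "supporting_slopes K g"
    and supp: "\<And>u. f u \<noteq> 0 \<Longrightarrow> \<bar>u\<bar> \<le> 1"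
    and irr: "\<alpha> \<notin> \<rat>" and \<alpha>: "\<bar>\<alpha>\<bar> \<le> 1"
    and S: "\<And>n. (\<Sum>k<n. 1 / ((real (Suc k))\<^sup>2 * dist_nearest_int (real (Suc k) * \<alpha>))) \<le> S"
    and R: "\<bar>x\<bar> + 2 * real M + 2 \<le> of_int R"
  shows "\<bar>(\<Sum>n<M. \<Sum>m=-R..R. f (x + real n * \<alpha> + of_int m)) - real M * integral UNIV f\<bar> \<le> 3 / 8 * K * S"
proof -
  have "\<exists>p q. q > N \<and> coprime p (int q) \<and> \<bar>real q * \<alpha> - of_int p\<bar> \<le> 1 / real q" for N
    using approximating_fraction[OF irr, of N] by metis
  then obtain P Q where PQ: "\<And>N. Q N > N" "\<And>N. coprime (P N) (int (Q N))"
      "\<And>N. \<bar>real (Q N) * \<alpha> - of_int (P N)\<bar> \<le> 1 / real (Q N)"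
    by metis
  have Qpos: "Q N > 0" for N using PQ(1)[of N] by simp
  have inv: "(\<lambda>N. 1 / real (Q N)) \<longlonglongrightarrow> 0"
  proof (rule tendsto_sandwich[of "\<lambda>_. 0" _ _ "\<lambda>N. 1 / real (Suc N)"])
    show "eventually (\<lambda>N. 1 / real (Q N) \<le> 1 / real (Suc N)) sequentially"
    proof (intro always_eventually allI)
      fix N show "1 / real (Q N) \<le> 1 / real (Suc N)"
        using PQ(1)[of N] by (intro divide_left_mono) auto
    qed
    show "(\<lambda>N. 1 / real (Suc N)) \<longlonglongrightarrow> 0" by (rule LIMSEQ_Suc[OF lim_1_over_n])
  qed auto
  have conv: "(\<lambda>N. of_int (P N) / real (Q N)) \<longlonglongrightarrow> \<alpha>"
  proof (rule LIMSEQ_iff[THEN iffD2], intro allI impI)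
    fix r :: real assume "r > 0"
    then obtain N0 where N0: "\<And>N. N \<ge> N0 \<Longrightarrow> 1 / real (Q N) < r"
      using inv[THEN LIMSEQ_D, of r] by auto
    have "norm (of_int (P N) / real (Q N) - \<alpha>) < r" if "N \<ge> N0" for N
    proof -
      have "of_int (P N) / real (Q N) - \<alpha> = (of_int (P N) - real (Q N) * \<alpha>) / real (Q N)"
        using Qpos[of N] by (simp add: field_simps)
      then have "norm (of_int (P N) / real (Q N) - \<alpha>) = \<bar>real (Q N) * \<alpha> - of_int (P N)\<bar> / real (Q N)"
        by (simp add: abs_minus_commute)
      also have "\<dots> \<le> \<bar>real (Q N) * \<alpha> - of_int (P N)\<bar> / 1"
        using Qpos[of N] by (intro divide_left_mono) auto
      also have "\<dots> \<le> 1 / real (Q N)" using PQ(3)[of N] by simp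
      finally show ?thesis using N0[OF that] by simp
    qed
    then show "\<exists>no. \<forall>n\<ge>no. norm (of_int (P n) / real (Q n) - \<alpha>) < r" by blast
  qed
  have K: "0 \<le> K" using supporting_slopes_Lipschitz[OF g, of 1 0] by simp
  have lip: "\<bar>f v - f u\<bar> \<le> K * \<bar>v - u\<bar>" for u v
    using supporting_slopes_Lipschitz[OF g, of v u] unfolding f by linarith
  have "K-lipschitz_on UNIV f"
    using lip K by (intro lipschitz_onI) (auto simp: dist_real_def)
  then have cont: "isCont f u" for u
    using lipschitz_on_continuous_on continuous_on_eq_continuous_at[OF open_UNIV] by blast
  have lim: "(\<lambda>N. \<bar>(\<Sum>n<M. \<Sum>m=-R..R. f (x + real n * (of_int (P N) / real (Q N)) + of_int m))
      - real M * integral UNIV f\<bar>)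
    \<longlonglongrightarrow> \<bar>(\<Sum>n<M. \<Sum>m=-R..R. f (x + real n * \<alpha> + of_int m)) - real M * integral UNIV f\<bar>"
    by (intro tendsto_intros isCont_tendsto_compose[OF cont] conv)
  have rhs: "(\<lambda>N. 3 / 8 * K * S + real M * (2 * of_int R * K * (1 / real (Q N))))
    \<longlonglongrightarrow> 3 / 8 * K * S + real M * (2 * of_int R * K * 0)"
    by (intro tendsto_intros inv)
  have "\<bar>(\<Sum>n<M. \<Sum>m=-R..R. f (x + real n * \<alpha> + of_int m)) - real M * integral UNIV f\<bar>
    \<le> 3 / 8 * K * S + real M * (2 * of_int R * K * 0)"
  proof (rule LIMSEQ_le[OF lim rhs], intro exI allI impI)
    fix N
    show "\<bar>(\<Sum>n<M. \<Sum>m=-R..R. f (x + real n * (of_int (P N) / real (Q N)) + of_int m))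
      - real M * integral UNIV f\<bar> \<le> 3 / 8 * K * S + real M * (2 * of_int R * K * (1 / real (Q N)))"
      using rational_orbit_sum_le[OF f g supp irr \<alpha> S R Qpos PQ(2,3), of N] by simp
  qed
  then show ?thesis by simp
qed

section \<open>Polygons in sheared coordinates\<close>

text \<open>Each halfspace of an irredundant system meets the polyhedron in a facet along its
  boundary line, and the facets of a two-dimensional polytope are its edges.\<close>

lemma polygon_eq_Inter_edge_halfspaces:
  assumes "convex_polygon P"
  obtains F and a :: "(real \<times> real) set \<Rightarrow> real \<times> real" and b
  where "finite F" "P = {z. \<forall>h\<in>F. a h \<bullet> z \<le> b h}" "\<forall>h\<in>F. a h \<noteq> 0"
    "\<forall>h\<in>F. (P \<inter> {z. a h \<bullet> z = b h}) edge_of P"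
proof -
  have P: "polytope P" "aff_dim P = 2" using assms by (auto simp: convex_polygon_def)
  then have hull: "affine hull P = UNIV" by (intro affine_hull_UNIV) simp
  have "polyhedron P" using P(1) by (rule polytope_imp_polyhedron)
  then obtain F where fin: "finite F" and seq: "P = (affine hull P) \<inter> \<Inter>F"
      and faces: "\<And>h. h \<in> F \<Longrightarrow> \<exists>a b. a \<noteq> 0 \<and> h = {x. a \<bullet> x \<le> b}"
      and min: "\<And>F'. F' \<subset> F \<Longrightarrow> P \<subset> (affine hull P) \<inter> \<Inter>F'"
    by (simp add: polyhedron_Int_affine_minimal) meson
  then obtain a b where ab: "\<And>h. h \<in> F \<Longrightarrow> a h \<noteq> 0 \<and> h = {x. a h \<bullet> x \<le> b h}"
    by metis
  show thesis
  proof (rule that[of F a b])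
    show "P = {z. \<forall>h\<in>F. a h \<bullet> z \<le> b h}"
    proof -
      have "z \<in> P \<longleftrightarrow> (\<forall>h\<in>F. a h \<bullet> z \<le> b h)" for z
      proof -
        have "z \<in> P \<longleftrightarrow> z \<in> \<Inter>F" using seq hull by auto
        also have "\<dots> \<longleftrightarrow> (\<forall>h\<in>F. a h \<bullet> z \<le> b h)" using ab by blast
        finally show ?thesis .
      qed
      then show ?thesis by blast
    qed
    show "\<forall>h\<in>F. a h \<noteq> 0" using ab by blast
    show "\<forall>h\<in>F. (P \<inter> {z. a h \<bullet> z = b h}) edge_of P"
    proof
      fix h assume "h \<in> F"
      then have "(P \<inter> {z. a h \<bullet> z = b h}) facet_of P"
        using facet_of_polyhedron_explicit[OF fin seq ab min] by blast
      then show "(P \<inter> {z. a h \<bullet> z = b h}) edge_of P"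
        using P(2) by (simp add: facet_of_def edge_of_def)
    qed
  qed (fact fin)
qed

lemma bounded_ray_zero:
  fixes z v :: "'a::real_normed_vector"
  assumes "bounded P" "\<And>r. r \<ge> 0 \<Longrightarrow> z + r *\<^sub>R v \<in> P"
  shows "v = 0"
proof (rule ccontr)
  assume "v \<noteq> 0"
  obtain B where B: "\<And>w. w \<in> P \<Longrightarrow> norm w \<le> B" using assms(1) unfolding bounded_iff by blast
  define r where "r = (\<bar>B\<bar> + norm z + 1) / norm v"
  have "r \<ge> 0" by (simp add: r_def)
  then have "norm (z + r *\<^sub>R v) \<le> B" using assms(2) B by blast
  moreover have "norm (r *\<^sub>R v) = \<bar>B\<bar> + norm z + 1" using \<open>v \<noteq> 0\<close> by (simp add: r_def)
  moreover have "norm (r *\<^sub>R v) \<le> norm (z + r *\<^sub>R v) + norm z"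
    using norm_triangle_ineq4[of "z + r *\<^sub>R v" z] by simp
  ultimately show False by linarith
qed

text \<open>In the sheared coordinates \<open>(u, t) = (x - \<alpha>\<^sub>1 y, y)\<close> the direction of \<open>\<alpha>\<close> is vertical and
  an edge at angle \<open>\<phi>\<close> has slope \<open>- (cot \<phi> + \<alpha>\<^sub>1) / |\<alpha>|\<^sup>2\<close>.\<close>

definition edge_slope :: "real \<Rightarrow> real \<Rightarrow> real" where
  "edge_slope \<alpha>\<^sub>1 \<phi> = - (cot \<phi> + \<alpha>\<^sub>1) / (1 + \<alpha>\<^sub>1\<^sup>2)"

text \<open>The normal \<open>a\<close> is orthogonal to the edge; if it were also orthogonal to
  \<open>(\<alpha>\<^sub>1, 1)\<close>, the edge would be parallel to that vector. Solving the
  orthogonality relation with the rotated vector for \<open>fst a\<close> produces the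
  slope.\<close>

lemma edge_halfspace_slope:
  fixes a :: "real \<times> real"
  assumes E: "E = P \<inter> {z. a \<bullet> z = b}" and a0: "a \<noteq> 0"
    and npar: "\<not> parallel_to_segment (\<alpha>\<^sub>1, 1) E"
    and par: "parallel_to_segment (rotate_vec \<phi> (\<alpha>\<^sub>1, 1)) E"
  shows "a \<bullet> (\<alpha>\<^sub>1, 1) \<noteq> 0" "fst a = - edge_slope \<alpha>\<^sub>1 \<phi> * (a \<bullet> (\<alpha>\<^sub>1, 1))"
proof -
  let ?r = "rotate_vec \<phi> (\<alpha>\<^sub>1, 1)"
  obtain p q c where pq: "E = closed_segment p q" "p \<noteq> q" "q - p = c *\<^sub>R ?r"
    using par unfolding parallel_to_segment_def by blast
  have "p \<in> E" "q \<in> E" using pq(1) by auto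
  then have ap: "a \<bullet> (q - p) = 0" using E by (simp add: inner_diff_right)
  have c0: "c \<noteq> 0" using pq(2,3) by auto
  obtain a1 a2 where a: "a = (a1, a2)" by (cases a)
  obtain d1 d2 where d: "q - p = (d1, d2)" by (cases "q - p")
  have ad: "a1 * d1 + a2 * d2 = 0" using ap unfolding a d by simp
  show nz: "a \<bullet> (\<alpha>\<^sub>1, 1) \<noteq> 0"
  proof
    assume "a \<bullet> (\<alpha>\<^sub>1, 1) = 0"
    then have a2: "a2 = - a1 * \<alpha>\<^sub>1" by (simp add: a)
    then have "a1 \<noteq> 0" using a0 by (auto simp: a zero_prod_def)
    moreover have "a1 * (d1 - \<alpha>\<^sub>1 * d2) = 0" using ad unfolding a2 by (simp add: algebra_simps)
    ultimately have "d1 = \<alpha>\<^sub>1 * d2" by simp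
    then have "q - p = d2 *\<^sub>R (\<alpha>\<^sub>1, 1)" by (simp add: d)
    then show False using npar pq(1,2) unfolding parallel_to_segment_def by blast
  qed
  \<comment> \<open>A vanishing sine would make the rotated vector, and so the edge, parallel to
    \<open>(\<alpha>\<^sub>1, 1)\<close>. Excluding it keeps \<open>cot\<close> away from its
    default value at a zero denominator.\<close>
  have s0: "sin \<phi> \<noteq> 0"
  proof
    assume "sin \<phi> = 0"
    then have "q - p = (c * cos \<phi>) *\<^sub>R (\<alpha>\<^sub>1, 1)" using pq(3) by (simp add: rotate_vec_def)
    then show False using npar pq(1,2) unfolding parallel_to_segment_def by blast
  qed
  have "a \<bullet> ?r = 0" using ap pq(3) c0 by simp
  then have "a1 * (cos \<phi> * \<alpha>\<^sub>1 - sin \<phi>) + a2 * (sin \<phi> * \<alpha>\<^sub>1 + cos \<phi>) = 0"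
    by (simp add: a rotate_vec_def)
  then have "a1 * sin \<phi> * (1 + \<alpha>\<^sub>1\<^sup>2) = (cos \<phi> + \<alpha>\<^sub>1 * sin \<phi>) * (a1 * \<alpha>\<^sub>1 + a2)"
    by (simp add: algebra_simps power2_eq_square)
  moreover have "1 + \<alpha>\<^sub>1\<^sup>2 > 0" by (simp add: add_pos_nonneg)
  ultimately have "a1 = (cos \<phi> + \<alpha>\<^sub>1 * sin \<phi>) * (a1 * \<alpha>\<^sub>1 + a2) / (sin \<phi> * (1 + \<alpha>\<^sub>1\<^sup>2))"
    using s0 by (simp add: eq_divide_eq mult.assoc)
  also have "\<dots> = (cos \<phi> + \<alpha>\<^sub>1 * sin \<phi>) / sin \<phi> / (1 + \<alpha>\<^sub>1\<^sup>2) * (a1 * \<alpha>\<^sub>1 + a2)"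
    by simp
  also have "(cos \<phi> + \<alpha>\<^sub>1 * sin \<phi>) / sin \<phi> = cot \<phi> + \<alpha>\<^sub>1"
    using s0 by (simp add: cot_def add_divide_distrib)
  finally show "fst a = - edge_slope \<alpha>\<^sub>1 \<phi> * (a \<bullet> (\<alpha>\<^sub>1, 1))"
    by (simp add: a edge_slope_def mult.commute add.commute minus_divide_left[symmetric] del: minus_add_distrib)
qed

text \<open>A halfspace bounds \<open>t\<close> from above or below according to the sign of
  \<open>a \<bullet> (\<alpha>\<^sub>1, 1)\<close>, which is never zero. Boundedness of
  \<open>P\<close> supplies both kinds, and as one slope on each side would leave an unbounded
  region, it also forces three edges.\<close>

lemma polygon_between_graphs:
  fixes \<alpha>\<^sub>1 :: real and P :: "(real \<times> real) set" and e :: "nat \<Rightarrow> (real \<times> real) set"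
  assumes P: "convex_polygon P"
    and e: "bij_betw e {1..N} {F. F edge_of P}"
    and npar: "\<And>k. k \<in> {1..N} \<Longrightarrow> \<not> parallel_to_segment (\<alpha>\<^sub>1, 1) (e k)"
    and par: "\<And>k. k \<in> {1..N} \<Longrightarrow> parallel_to_segment (rotate_vec (\<phi> k) (\<alpha>\<^sub>1, 1)) (e k)"
  obtains U L :: "(real \<times> real) set"
  where "finite U" "finite L" "U \<noteq> {}" "L \<noteq> {}"
    "\<forall>u t. (u + \<alpha>\<^sub>1 * t, t) \<in> P \<longleftrightarrow> (\<forall>(m, c)\<in>U. t \<le> m * u + c) \<and> (\<forall>(m, c)\<in>L. m * u + c \<le> t)"
    "\<forall>(m, c)\<in>U \<union> L. \<exists>k\<in>{1..N}. m = edge_slope \<alpha>\<^sub>1 (\<phi> k)"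
    "3 \<le> N"
proof -
  obtain F and a :: "(real \<times> real) set \<Rightarrow> real \<times> real" and b where F: "finite F" "P = {z. \<forall>h\<in>F. a h \<bullet> z \<le> b h}"
      and a0': "\<forall>h\<in>F. a h \<noteq> 0"
      and edge: "\<forall>h\<in>F. (P \<inter> {z. a h \<bullet> z = b h}) edge_of P"
    by (rule polygon_eq_Inter_edge_halfspaces[OF P])
  have a0: "a h \<noteq> 0" if "h \<in> F" for h using a0' that by blast
  define ix where "ix = (\<lambda>h. inv_into {1..N} e (P \<inter> {z. a h \<bullet> z = b h}))"
  have img: "P \<inter> {z. a h \<bullet> z = b h} \<in> e ` {1..N}" if "h \<in> F" for h
    using edge that bij_betw_imp_surj_on[OF e] by simp
  have ix: "ix h \<in> {1..N}" "e (ix h) = P \<inter> {z. a h \<bullet> z = b h}" if "h \<in> F" for h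
    unfolding ix_def using inv_into_into[OF img[OF that]] f_inv_into_f[OF img[OF that]] .
  define B where "B = (\<lambda>h. a h \<bullet> (\<alpha>\<^sub>1, 1))"
  define m where "m = (\<lambda>h. edge_slope \<alpha>\<^sub>1 (\<phi> (ix h)))"
  define c where "c = (\<lambda>h. b h / B h)"
  have B0: "B h \<noteq> 0" and fa: "fst (a h) = - m h * B h" if h: "h \<in> F" for h
    using edge_halfspace_slope[OF ix(2)[OF h] a0[OF h] npar[OF ix(1)[OF h]] par[OF ix(1)[OF h]]]
    by (simp_all add: B_def m_def)
  have ain: "a h \<bullet> (u + \<alpha>\<^sub>1 * t, t) = B h * (t - m h * u)" if h: "h \<in> F" for h u t
  proof -
    have "a h \<bullet> (u + \<alpha>\<^sub>1 * t, t) = fst (a h) * u + B h * t"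
      by (cases "a h") (simp add: B_def algebra_simps)
    then show ?thesis by (simp add: fa[OF h] algebra_simps)
  qed
  define U where "U = {h \<in> F. B h > 0}"
  define L where "L = {h \<in> F. B h < 0}"
  have FUL: "F = U \<union> L" using B0 by (auto simp: U_def L_def neq_iff)
  have halfU: "a h \<bullet> (u + \<alpha>\<^sub>1 * t, t) \<le> b h \<longleftrightarrow> t \<le> m h * u + c h" if h: "h \<in> U" for h u t
  proof -
    have "B h > 0" "h \<in> F" using h by (auto simp: U_def)
    then show ?thesis unfolding ain[OF \<open>h \<in> F\<close>] c_def by (simp add: field_simps)
  qed
  have halfL: "a h \<bullet> (u + \<alpha>\<^sub>1 * t, t) \<le> b h \<longleftrightarrow> m h * u + c h \<le> t" if h: "h \<in> L" for h u t
  proof -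
    have "B h < 0" "h \<in> F" using h by (auto simp: L_def)
    then show ?thesis unfolding ain[OF \<open>h \<in> F\<close>] c_def by (simp add: field_simps)
  qed
  have mem: "(u + \<alpha>\<^sub>1 * t, t) \<in> P \<longleftrightarrow> (\<forall>h\<in>U. t \<le> m h * u + c h) \<and> (\<forall>h\<in>L. m h * u + c h \<le> t)" for u t
    unfolding F(2) mem_Collect_eq using halfU halfL FUL by blast
  have line: "z \<in> {z. a h \<bullet> z = b h} \<longleftrightarrow> snd z = m h * (fst z - \<alpha>\<^sub>1 * snd z) + c h" if h: "h \<in> F" for h z
  proof -
    have "a h \<bullet> z = B h * (snd z - m h * (fst z - \<alpha>\<^sub>1 * snd z))"
      using ain[OF h, of "fst z - \<alpha>\<^sub>1 * snd z" "snd z"] by simp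
    then have "a h \<bullet> z = b h \<longleftrightarrow> snd z - m h * (fst z - \<alpha>\<^sub>1 * snd z) = c h"
      using B0[OF h] unfolding c_def nonzero_eq_divide_eq[OF B0[OF h]] by (simp only: mult.commute)
    then show ?thesis by (simp add: diff_eq_eq add.commute)
  qed
  have bdd: "bounded P" using P polytope_imp_bounded by (auto simp: convex_polygon_def)
  have "P \<noteq> {}" using P by (auto simp: convex_polygon_def)
  then obtain x y where xy: "(x, y) \<in> P" by auto
  define u where "u = x - \<alpha>\<^sub>1 * y"
  have uy: "(u + \<alpha>\<^sub>1 * y, y) \<in> P" using xy by (simp add: u_def)
  \<comment> \<open>A direction that satisfies all homogeneous inequalities spans a ray inside the
    bounded set \<open>P\<close>, so it must be zero.\<close>
  have recession: "d1 = 0 \<and> d2 = 0" if up: "\<And>h. h \<in> U \<Longrightarrow> d2 \<le> m h * d1" and low: "\<And>h. h \<in> L \<Longrightarrow> m h * d1 \<le> d2" for d1 d2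
  proof -
    have "(u + \<alpha>\<^sub>1 * y, y) + r *\<^sub>R (d1 + \<alpha>\<^sub>1 * d2, d2) \<in> P" if r: "r \<ge> 0" for r
    proof -
      have "((u + r * d1) + \<alpha>\<^sub>1 * (y + r * d2), y + r * d2) \<in> P"
        unfolding mem
      proof (intro conjI ballI)
        fix h assume h: "h \<in> U"
        have "r * d2 \<le> r * (m h * d1)" using up[OF h] r by (rule mult_left_mono)
        moreover have "y \<le> m h * u + c h" using uy h mem by blast
        ultimately show "y + r * d2 \<le> m h * (u + r * d1) + c h" by (simp add: algebra_simps)
      next
        fix h assume h: "h \<in> L"
        have "r * (m h * d1) \<le> r * d2" using low[OF h] r by (rule mult_left_mono)
        moreover have "m h * u + c h \<le> y" using uy h mem by blast
        ultimately show "m h * (u + r * d1) + c h \<le> y + r * d2" by (simp add: algebra_simps)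
      qed
      then show ?thesis by (simp add: algebra_simps)
    qed
    from bounded_ray_zero[OF bdd this] show ?thesis by (auto simp: zero_prod_def)
  qed
  \<comment> \<open>Without upper constraints the direction \<open>d1 = 0\<close>,
    \<open>d2 = 1\<close> would recede; without lower ones its opposite would.\<close>
  have Une: "U \<noteq> {}" using recession[of 1 0] by auto
  have Lne: "L \<noteq> {}" using recession[of "-1" 0] by auto
  \<comment> \<open>A common edge means equal slopes and a common point, hence the same line above
    and below; \<open>P\<close> would lie in that line, against dimension 2.\<close>
  have disj: "ix h \<noteq> ix h'" if h: "h \<in> U" "h' \<in> L" for h h'
  proof
    assume eq: "ix h = ix h'"
    have hF: "h \<in> F" "h' \<in> F" using h by (auto simp: U_def L_def)
    have "e (ix h) \<noteq> {}"
      using par[OF ix(1)[OF hF(1)]] by (auto simp: parallel_to_segment_def)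
    then obtain z where "z \<in> e (ix h)" by blast
    then have "z \<in> {z. a h \<bullet> z = b h}" "z \<in> {z. a h' \<bullet> z = b h'}"
      using ix(2)[OF hF(1)] ix(2)[OF hF(2)] eq by auto
    moreover have mm: "m h = m h'" using eq by (simp add: m_def)
    ultimately have cc: "c h = c h'" unfolding line[OF hF(1)] line[OF hF(2)] by simp
    have "P \<subseteq> {z. a h \<bullet> z = b h}"
    proof
      fix z assume "z \<in> P"
      then have "((fst z - \<alpha>\<^sub>1 * snd z) + \<alpha>\<^sub>1 * snd z, snd z) \<in> P" by simp
      then have "snd z = m h * (fst z - \<alpha>\<^sub>1 * snd z) + c h"
        unfolding mem using h mm cc by (intro antisym) auto
      then show "z \<in> {z. a h \<bullet> z = b h}" unfolding line[OF hF(1)] .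
    qed
    then have "aff_dim P \<le> aff_dim {z. a h \<bullet> z = b h}" by (rule aff_dim_subset)
    also have "\<dots> = 1" using a0[OF hF(1)] by (simp add: aff_dim_hyperplane)
    finally show False using P by (simp add: convex_polygon_def)
  qed
  \<comment> \<open>With at most two edges, \<open>disj\<close> leaves one slope for all of
    \<open>U\<close> and one for all of \<open>L\<close>. The direction of the upper line in which
    it does not approach the lower one then recedes.\<close>
  have N3: "3 \<le> N"
  proof (rule ccontr)
    assume "\<not> 3 \<le> N"
    obtain hU hL where hU: "hU \<in> U" and hL: "hL \<in> L" using Une Lne by blast
    have F12: "ix h = 1 \<or> ix h = 2" if "h \<in> F" for h using ix(1)[OF that] \<open>\<not> 3 \<le> N\<close> by auto
    have "ix h = ix hU" if "h \<in> U" for h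
      using F12[of h] F12[of hU] F12[of hL] disj[OF that hL] disj[OF hU hL] that hU hL FUL by auto
    then have mU: "m h = m hU" if "h \<in> U" for h using that by (simp add: m_def)
    have "ix h = ix hL" if "h \<in> L" for h
      using F12[of h] F12[of hU] F12[of hL] disj[OF hU that] disj[OF hU hL] that hU hL FUL by auto
    then have mL: "m h = m hL" if "h \<in> L" for h using that by (simp add: m_def)
    show False
    proof (cases "m hL \<le> m hU")
      case True
      then show False using recession[of "m hU" 1] mU mL by auto
    next
      case False
      then show False using recession[of "- m hU" "- 1"] mU mL by auto
    qed
  qed
  show thesis
  proof (rule that[of "(\<lambda>h. (m h, c h)) ` U" "(\<lambda>h. (m h, c h)) ` L"])
    show "finite ((\<lambda>h. (m h, c h)) ` U)" "finite ((\<lambda>h. (m h, c h)) ` L)"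
      using F(1) by (auto simp: U_def L_def)
    show "\<forall>u t. (u + \<alpha>\<^sub>1 * t, t) \<in> P \<longleftrightarrow> (\<forall>(m, c)\<in>(\<lambda>h. (m h, c h)) ` U. t \<le> m * u + c)
        \<and> (\<forall>(m, c)\<in>(\<lambda>h. (m h, c h)) ` L. m * u + c \<le> t)"
      unfolding mem by simp
    show "\<forall>(m', c')\<in>(\<lambda>h. (m h, c h)) ` U \<union> (\<lambda>h. (m h, c h)) ` L. \<exists>k\<in>{1..N}. m' = edge_slope \<alpha>\<^sub>1 (\<phi> k)"
      using ix(1) FUL unfolding m_def by blast
  qed (use Une Lne N3 in auto)
qed

text \<open>At \<open>u\<close> the minimum and the maximum are attained by two affine functions.
  The difference of their slopes supports, since elsewhere the remaining functions only lower the
  minimum and raise the maximum.\<close>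

lemma supporting_slopes_chord:
  fixes U L :: "(real \<times> real) set"
  assumes fin: "finite U" "finite L" and ne: "U \<noteq> {}" "L \<noteq> {}"
    and slopes: "\<And>m c m' c'. (m, c) \<in> U \<Longrightarrow> (m', c') \<in> L \<Longrightarrow> \<bar>m - m'\<bar> \<le> K"
  shows "supporting_slopes K (\<lambda>u. Min ((\<lambda>(m, c). m * u + c) ` U) - Max ((\<lambda>(m, c). m * u + c) ` L))"
  unfolding supporting_slopes_def
proof
  fix u
  define hi where "hi = (\<lambda>u. Min ((\<lambda>(m, c). m * u + c) ` U))"
  define lo where "lo = (\<lambda>u. Max ((\<lambda>(m, c). m * u + c) ` L))"
  have "hi u \<in> (\<lambda>(m, c). m * u + c) ` U" unfolding hi_def using fin ne by (intro Min_in) auto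
  then obtain m c where mc: "(m, c) \<in> U" "hi u = m * u + c" by auto
  have "lo u \<in> (\<lambda>(m, c). m * u + c) ` L" unfolding lo_def using fin ne by (intro Max_in) auto
  then obtain m' c' where mc': "(m', c') \<in> L" "lo u = m' * u + c'" by auto
  have "hi v - lo v \<le> hi u - lo u + (m - m') * (v - u)" for v
  proof -
    have "hi v \<le> m * v + c" unfolding hi_def using fin mc(1) by (intro Min_le) force+
    moreover have "m' * v + c' \<le> lo v" unfolding lo_def using fin mc'(1) by (intro Max_ge) force+
    ultimately show ?thesis unfolding mc(2) mc'(2) by (simp add: algebra_simps)
  qed
  then show "\<exists>s. \<bar>s\<bar> \<le> K \<and> (\<forall>v. Min ((\<lambda>(m, c). m * v + c) ` U) - Max ((\<lambda>(m, c). m * v + c) ` L)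
      \<le> Min ((\<lambda>(m, c). m * u + c) ` U) - Max ((\<lambda>(m, c). m * u + c) ` L) + s * (v - u))"
    using slopes[OF mc(1) mc'(1)] unfolding hi_def lo_def by blast
qed

lemma supporting_slopes_continuous:
  assumes "supporting_slopes K g"
  shows "continuous_on A g"
proof -
  have "0 \<le> K" using supporting_slopes_Lipschitz[OF assms, of 1 0] by simp
  then have "K-lipschitz_on UNIV g"
    using supporting_slopes_Lipschitz[OF assms] by (intro lipschitz_onI) (auto simp: dist_real_def)
  then show ?thesis using lipschitz_on_continuous_on continuous_on_subset by blast
qed

section \<open>The linear flow\<close>

text \<open>The shear is a translation on each horizontal line and so preserves area; exchanging the
  order of integration puts the chords inside.\<close>

lemma emeasure_shear:
  fixes P :: "(real \<times> real) set"
  assumes [measurable]: "P \<in> sets borel"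
  shows "emeasure lborel P = (\<integral>\<^sup>+u. (\<integral>\<^sup>+t. indicator P (u + a * t, t) \<partial>lborel) \<partial>lborel)"
proof -
  have [measurable]: "P \<in> sets (borel \<Otimes>\<^sub>M borel)" using assms by (simp only: borel_prod)
  have "emeasure lborel P = (\<integral>\<^sup>+z. indicator P z \<partial>(lborel \<Otimes>\<^sub>M lborel))"
    by (simp add: lborel_prod)
  also have "\<dots> = (\<integral>\<^sup>+t. (\<integral>\<^sup>+x. indicator P (x, t) \<partial>lborel) \<partial>lborel)"
    by (rule lborel_pair.nn_integral_snd[symmetric]) measurable
  also have "\<dots> = (\<integral>\<^sup>+t. (\<integral>\<^sup>+u. indicator P (u + a * t, t) \<partial>lborel) \<partial>lborel)"
  proof (rule nn_integral_cong)
    fix t :: real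
    have "(\<integral>\<^sup>+x. indicator P (x, t) \<partial>lborel) = ennreal \<bar>1\<bar> * (\<integral>\<^sup>+u. indicator P (a * t + 1 * u, t) \<partial>lborel)"
    proof (rule nn_integral_real_affine)
      show "(\<lambda>x. indicator P (x, t)) \<in> borel_measurable borel" by measurable
    qed simp
    then show "(\<integral>\<^sup>+x. indicator P (x, t) \<partial>lborel) = (\<integral>\<^sup>+u. indicator P (u + a * t, t) \<partial>lborel)"
      by (simp add: add.commute)
  qed
  also have "\<dots> = (\<integral>\<^sup>+u. (\<integral>\<^sup>+t. indicator P (u + a * t, t) \<partial>lborel) \<partial>lborel)"
    by (rule lborel_pair.Fubini') measurable
  finally show ?thesis .
qed

text \<open>Only the translate by \<open>- \<lfloor>y\<rfloor>\<close> can meet the closed unit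
  square. For integer \<open>y\<close> both vertical sides could be hit, which is why integers are
  excluded.\<close>

lemma indicator_frac_eq_sum:
  assumes P: "P \<subseteq> unit_square" and y: "y \<notin> \<int>" "\<bar>y\<bar> + 1 \<le> of_int R"
  shows "indicat_real P (frac y, t) = (\<Sum>m=-R..R. indicat_real P (y + of_int m, t))"
proof -
  have zero: "indicat_real P (y + of_int m, t) = 0" if "m \<noteq> - \<lfloor>y\<rfloor>" for m
  proof -
    have "(y + of_int m, t) \<notin> P"
    proof
      assume "(y + of_int m, t) \<in> P"
      then have b: "0 \<le> y + of_int m" "y + of_int m \<le> 1" using P by (auto simp: unit_square_def)
      have "y + of_int m \<noteq> 1" using y(1) by (metis Ints_1 Ints_diff Ints_of_int add_diff_cancel_right')
      then have "\<lfloor>y\<rfloor> = - m" using b by (intro floor_unique) auto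
      then show False using that by simp
    qed
    then show ?thesis by simp
  qed
  have "\<lfloor>y\<rfloor> \<in> {-R..R}" using y(2) by (auto simp: le_floor_iff floor_le_iff)
  then have "(\<Sum>m=-R..R. indicat_real P (y + of_int m, t)) = (\<Sum>m\<in>{- \<lfloor>y\<rfloor>}. indicat_real P (y + of_int m, t))"
    using zero by (intro sum.mono_neutral_right) auto
  then show ?thesis by (simp add: frac_def)
qed

lemma negligible_Ints_preimage:
  fixes a b :: real
  assumes "b \<noteq> 0"
  shows "negligible {r. a + b * r \<in> \<int>}"
proof -
  have "{r. a + b * r \<in> \<int>} \<subseteq> (\<lambda>j::int. (of_int j - a) / b) ` UNIV"
  proof
    fix r assume "r \<in> {r. a + b * r \<in> \<int>}"
    then obtain j where "a + b * r = of_int j" by (auto elim: Ints_cases)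
    then have "r = (of_int j - a) / b" using assms by (simp add: field_simps)
    then show "r \<in> (\<lambda>j::int. (of_int j - a) / b) ` UNIV" by blast
  qed
  then have "countable {r. a + b * r \<in> \<int>}" by (rule countable_subset) simp
  then have "{r. a + b * r \<in> \<int>} \<in> null_sets lborel" by (rule countable_imp_null_set_lborel)
  then show ?thesis by (simp add: negligible_iff_null_sets null_sets_completionI)
qed

text \<open>The horizontal wrapping unfolds into a sum over integer translates, except at the
  negligible set of parameters where the orbit crosses an integer abscissa.\<close>

lemma cell_has_integral:
  assumes P: "P \<subseteq> unit_square" and a: "0 < a" "a \<le> 1"
    and f: "\<And>u. ((\<lambda>t. indicat_real P (u + a * t, t)) has_integral f u) {0..1}"
    and R: "\<bar>y\<bar> + 2 \<le> of_int R"
  shows "((\<lambda>r. indicat_real P (frac (y + a * r), r)) has_integral (\<Sum>m=-R..R. f (y + of_int m))) {0..1}"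
proof (rule has_integral_spike[OF negligible_Ints_preimage])
  show "((\<lambda>r. \<Sum>m=-R..R. indicat_real P (y + of_int m + a * r, r)) has_integral (\<Sum>m=-R..R. f (y + of_int m))) {0..1}"
    by (intro has_integral_sum f) simp
  fix r assume r: "r \<in> {0..1} - {r. y + a * r \<in> \<int>}"
  then have "0 \<le> a * r" "a * r \<le> 1" using a by (auto intro: mult_le_one)
  then have "\<bar>y + a * r\<bar> + 1 \<le> of_int R" using R by linarith
  then have "indicat_real P (frac (y + a * r), r) = (\<Sum>m=-R..R. indicat_real P (y + a * r + of_int m, r))"
    using indicator_frac_eq_sum[OF P, of "y + a * r"] r by simp
  then show "indicat_real P (frac (y + a * r), r) = (\<Sum>m=-R..R. indicat_real P (y + of_int m + a * r, r))"
    by (simp add: add_ac)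
qed (use a in simp)

text \<open>At time \<open>-s2\<close> the orbit has height 0, so each unit of time from there runs
  through one full cell; cell \<open>n\<close> is entered at abscissa
  \<open>s1 - s2 * a + n * a\<close>.\<close>

lemma flow_has_integral:
  assumes P: "P \<subseteq> unit_square" and a: "0 < a" "a \<le> 1"
    and f: "\<And>u. ((\<lambda>t. indicat_real P (u + a * t, t)) has_integral f u) {0..1}"
    and R: "\<bar>s1 - s2 * a\<bar> + real M + 2 \<le> of_int R"
  shows "((\<lambda>t. indicat_real P (frac (s1 + t * a), frac (s2 + t)))
      has_integral (\<Sum>n<M. \<Sum>m=-R..R. f (s1 - s2 * a + real n * a + of_int m))) {-s2..-s2 + real M}"
  using R
proof (induction M)
  case 0
  have "((\<lambda>t. indicat_real P (frac (s1 + t * a), frac (s2 + t))) has_integral 0) {-s2}"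
    by (rule has_integral_negligible[of "{-s2}"]) auto
  then show ?case by simp
next
  case (Suc n)
  let ?h = "\<lambda>t. indicat_real P (frac (s1 + t * a), frac (s2 + t))"
  define y where "y = s1 - s2 * a + real n * a"
  have "0 \<le> real n * a" "real n * a \<le> real n" using a by (auto intro: mult_left_le)
  then have "\<bar>y\<bar> + 2 \<le> of_int R" using Suc.prems unfolding y_def by linarith
  from cell_has_integral[OF P a f this]
  have "((\<lambda>r. indicat_real P (frac (y + a * r), r)) has_integral (\<Sum>m=-R..R. f (y + of_int m))) (cbox 0 1)"
    by simp
  from has_integral_affinity'[OF this, of 1 "s2 - real n"]
  have shifted: "((\<lambda>t. indicat_real P (frac (y + a * (t + (s2 - real n))), t + (s2 - real n)))
      has_integral (\<Sum>m=-R..R. f (y + of_int m))) {-s2 + real n..-s2 + real (Suc n)}"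
    by (simp add: algebra_simps)
  have "(?h has_integral (\<Sum>m=-R..R. f (y + of_int m))) {-s2 + real n..-s2 + real (Suc n)}"
  \<comment> \<open>At the right endpoint the fractional part drops to 0 while the shifted parameter
    is 1, so this point is removed.\<close>
  proof (rule has_integral_spike[of "{-s2 + real (Suc n)}", OF _ _ shifted])
    fix t assume "t \<in> {-s2 + real n..-s2 + real (Suc n)} - {-s2 + real (Suc n)}"
    then have "frac (s2 + t) = s2 + t - of_int (int n)"
      by (subst frac_unique_iff) auto
    moreover have "y + a * (t + (s2 - real n)) = s1 + t * a" by (simp add: y_def algebra_simps)
    moreover have "s2 + t - of_int (int n) = t + (s2 - real n)" by simp
    ultimately show "?h t = indicat_real P (frac (y + a * (t + (s2 - real n))), t + (s2 - real n))"
      by (simp only:)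
  qed simp
  moreover have "(?h has_integral (\<Sum>n<n. \<Sum>m=-R..R. f (s1 - s2 * a + real n * a + of_int m))) {-s2..-s2 + real n}"
    using Suc by simp
  ultimately have "(?h has_integral ((\<Sum>n<n. \<Sum>m=-R..R. f (s1 - s2 * a + real n * a + of_int m))
      + (\<Sum>m=-R..R. f (y + of_int m)))) {-s2..-s2 + real (Suc n)}"
    by (intro has_integral_combine[of "-s2" "-s2 + real n"]) auto
  then show ?case by (simp add: y_def)
qed

text \<open>Completing the orbit segment to whole unit cells \<open>[j - s\<^sub>2, j + 1 - s\<^sub>2]\<close> costs at most 1 at
  either end.\<close>

lemma discrepancy_le_orbit_sum:
  assumes P: "P \<subseteq> unit_square" and a: "0 < a" "a \<le> 1"
    and f: "\<And>u. ((\<lambda>t. indicat_real P (u + a * t, t)) has_integral f u) {0..1}"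
    and s: "s \<in> unit_square" and T: "T > 0"
    and mP: "measure lebesgue P \<le> 1"
  obtains M :: nat and x :: real
  where "\<forall>R::int. \<bar>x\<bar> + 2 * real M + 3 \<le> of_int R \<longrightarrow>
    \<bar>discrepancy T s (a, 1) P\<bar> \<le> 2 + \<bar>(\<Sum>n<M. \<Sum>m=-R..R. f (x + real n * a + of_int m)) - real M * measure lebesgue P\<bar>"
proof -
  obtain s1 s2 where s12: "s = (s1, s2)" by (cases s)
  have s2: "0 \<le> s2" "s2 \<le> 1" using s by (auto simp: s12 unit_square_def)
  define M where "M = nat \<lfloor>T + s2\<rfloor>"
  define b where "b = - s2 + real M"
  have "0 \<le> \<lfloor>T + s2\<rfloor>" using T s2 by simp
  then have "real M = of_int \<lfloor>T + s2\<rfloor>" by (simp add: M_def)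
  then have b: "b \<le> T" "T \<le> b + 1" "- s2 \<le> b" unfolding b_def by linarith+
  define h where "h = (\<lambda>t. indicat_real P (frac (s1 + t * a), frac (s2 + t)))"
  define \<Lambda> where "\<Lambda> = measure lebesgue P"
  have \<Lambda>: "0 \<le> \<Lambda>" "\<Lambda> \<le> 1" using mP by (simp_all add: \<Lambda>_def)
  have "\<bar>discrepancy T s (a, 1) P\<bar> \<le> 2 + \<bar>(\<Sum>n<M. \<Sum>m=-R..R. f (s1 - s2 * a + real n * a + of_int m)) - real M * \<Lambda>\<bar>"
    if R: "\<bar>s1 - s2 * a\<bar> + 2 * real M + 3 \<le> of_int R" for R :: int
  proof -
    define G where "G = (\<Sum>n<M. \<Sum>m=-R..R. f (s1 - s2 * a + real n * a + of_int m))"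
    have G: "(h has_integral G) {-s2..b}"
      unfolding h_def G_def b_def using R by (intro flow_has_integral[OF P a f]) simp
    \<comment> \<open>One more cell reaches up to \<open>T\<close> or beyond. It raises the constant
      2 that suffices for \<open>M\<close> cells to the 3 demanded of \<open>R\<close>.\<close>
    have "h integrable_on {-s2..-s2 + real (Suc M)}"
      unfolding h_def
      using R by (intro has_integral_integrable[OF flow_has_integral[OF P a f, where R = R]]) simp
    then have int: "h integrable_on {c..d}" if "- s2 \<le> c" "d \<le> T" for c d
      by (rule integrable_on_subinterval) (use that b in \<open>auto simp: b_def\<close>)
    have bounds: "0 \<le> integral {c..d} h" "integral {c..d} h \<le> d - c" if "- s2 \<le> c" "c \<le> d" "d \<le> T" for c d
    proof -
      show "0 \<le> integral {c..d} h"
        by (intro integral_nonneg int that) (simp add: h_def)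
      have "integral {c..d} h \<le> integral {c..d} (\<lambda>_. 1)"
        by (intro integral_le int that) (auto simp: h_def indicator_def)
      then show "integral {c..d} h \<le> d - c" using that by simp
    qed
    have "discrepancy T s (a, 1) P = (LINT t:{0..T}|lebesgue. h t) - T * \<Lambda>"
      by (simp add: discrepancy_def h_def s12 \<Lambda>_def)
    also have "(LINT t:{0..T}|lebesgue. h t) = integral {0..T} h"
    proof (rule set_lebesgue_integral_eq_integral(2))
      show "set_integrable lebesgue {0..T} h"
        using int[of 0 T] s2 by (intro nonnegative_absolutely_integrable_1) (simp_all add: h_def)
    qed
    finally have disc: "discrepancy T s (a, 1) P = integral {0..T} h - T * \<Lambda>" .
    have c1: "integral {-s2..0} h + integral {0..T} h = integral {-s2..T} h"
      using s2 T by (intro Henstock_Kurzweil_Integration.integral_combine int) auto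
    have c2: "integral {-s2..b} h + integral {b..T} h = integral {-s2..T} h"
      using b by (intro Henstock_Kurzweil_Integration.integral_combine int) auto
    have c3: "integral {-s2..b} h = G" using G by (rule integral_unique)
    have J1: "0 \<le> integral {-s2..0} h" "integral {-s2..0} h \<le> s2"
      using bounds[of "-s2" 0] s2 T by auto
    have J2: "0 \<le> integral {b..T} h" "integral {b..T} h \<le> T - b" using bounds[of b T] b by auto
    have e1: "0 \<le> s2 * \<Lambda>" "s2 * \<Lambda> \<le> s2" using s2 \<Lambda> by (auto intro: mult_left_le)
    have e2: "0 \<le> (T - b) * \<Lambda>" "(T - b) * \<Lambda> \<le> T - b" using b \<Lambda> by (auto intro: mult_left_le)
    \<comment> \<open>Each of the last two brackets is a difference of two numbers between 0 and the
      length of its piece, and the lengths \<open>T - b\<close> and \<open>s2\<close> are at most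
      1.\<close>
    have "discrepancy T s (a, 1) P = (G - real M * \<Lambda>) + (integral {b..T} h - (T - b) * \<Lambda>) - (integral {-s2..0} h - s2 * \<Lambda>)"
      using disc c1 c2 c3 by (simp add: b_def algebra_simps)
    then show ?thesis using J1 J2 e1 e2 b s2 unfolding G_def[symmetric] by linarith
  qed
  then show thesis unfolding \<Lambda>_def by (intro that[of "s1 - s2 * a" M] allI impI)
qed

section \<open>The chord function of a polygon\<close>

text \<open>Machin's formula \<open>pi / 4 = 4 * arctan (1 / 5) - arctan (1 / 239)\<close>, with the
  second term dropped and \<open>arctan x \<le> x\<close> in the first.\<close>

lemma pi_le_16_5: "pi \<le> 16 / 5"
proof -
  have "arctan x \<le> x" if "0 \<le> x" for x :: real
    using abs_arctan_le[of x] that by simp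
  from this[of "1 / 5"] have "arctan (1 / 5) \<le> 1 / 5" by simp
  moreover have "0 \<le> arctan (1 / 239 :: real)" by simp
  ultimately show ?thesis using machin by linarith
qed

text \<open>With \<open>pi \<le> 16 / 5\<close>, \<open>3 / 8 * pi\<^sup>2\<close> is at most 3.84,
  below \<open>4 \<le> N + 1\<close>. The square of the norm in the denominator may be weakened to
  the norm itself, which is at least 1.\<close>

lemma coefficient_le:
  fixes K S \<alpha>\<^sub>1 :: real
  assumes "3 \<le> N" "0 \<le> K" "0 \<le> S"
  shows "3 / 8 * (K / (1 + \<alpha>\<^sub>1\<^sup>2)) * S \<le> (real N + 1) / (pi\<^sup>2 * norm (\<alpha>\<^sub>1, 1 :: real)) * K * S"
proof -
  define n where "n = norm (\<alpha>\<^sub>1, 1 :: real)"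
  have nrm: "n = sqrt (1 + \<alpha>\<^sub>1\<^sup>2)" by (simp add: n_def norm_Pair add.commute)
  have ge1: "1 \<le> n" unfolding nrm by simp
  have sq: "1 + \<alpha>\<^sub>1\<^sup>2 = n * n" unfolding nrm by (simp add: add_nonneg_nonneg)
  have n2: "1 / (n * n) \<le> 1 / n" using ge1 by (simp add: field_simps)
  have "pi\<^sup>2 \<le> (16 / 5)\<^sup>2" using pi_le_16_5 by (intro power_mono) auto
  then have pi2: "3 / 8 * pi\<^sup>2 \<le> 4" by (simp add: power2_eq_square)
  have "3 / 8 \<le> 4 / pi\<^sup>2" using pi2 by (simp add: field_simps)
  also have "\<dots> \<le> (real N + 1) / pi\<^sup>2" using assms(1) by (intro divide_right_mono) auto
  finally have "3 / 8 * (1 / (n * n)) \<le> (real N + 1) / pi\<^sup>2 * (1 / n)"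
    using n2 ge1 by (intro mult_mono) auto
  then have "3 / 8 * (1 / (n * n)) * (K * S) \<le> (real N + 1) / pi\<^sup>2 * (1 / n) * (K * S)"
    using assms by (intro mult_right_mono) auto
  then show ?thesis unfolding sq n_def[symmetric] by (simp add: mult_ac)
qed

lemma edge_slope_diff_le:
  assumes "\<bar>cot x - cot y\<bar> \<le> B"
  shows "\<bar>edge_slope a x - edge_slope a y\<bar> \<le> B / (1 + a\<^sup>2)"
proof -
  have pos: "0 < 1 + a\<^sup>2" by (simp add: add_pos_nonneg)
  have "edge_slope a x - edge_slope a y = - (cot x - cot y) / (1 + a\<^sup>2)"
    unfolding edge_slope_def diff_divide_distrib[symmetric] by simp
  then have "\<bar>edge_slope a x - edge_slope a y\<bar> = \<bar>cot x - cot y\<bar> / (1 + a\<^sup>2)"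
    using pos by (simp add: abs_divide)
  then show ?thesis using assms pos by (simp add: divide_right_mono)
qed

lemma measure_subset_unit_square:
  assumes "P \<subseteq> unit_square" "P \<in> sets borel"
  shows "emeasure lborel P \<le> 1"
proof -
  have us: "unit_square = cbox (0, 0) (1, 1)" by (simp add: unit_square_def cbox_Pair_eq)
  have "emeasure lborel P \<le> emeasure lborel unit_square"
    using assms by (intro emeasure_mono) (simp_all add: us)
  also have "emeasure lborel unit_square = emeasure (lborel \<Otimes>\<^sub>M lborel) ({0..1 :: real} \<times> {0..1 :: real})"
    by (simp only: unit_square_def lborel_prod)
  also have "\<dots> = emeasure lborel {0..1 :: real} * emeasure lborel {0..1 :: real}"
    by (rule lborel.emeasure_pair_measure_Times) simp_all
  finally show ?thesis by simp
qed

text \<open>\<open>f u\<close> is the length of the chord that \<open>P\<close> cuts from the line \<open>t \<mapsto> (u + \<alpha>\<^sub>1 t, t)\<close>, measured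
  in the parameter \<open>t\<close>.\<close>

lemma polygon_chord_function:
  fixes \<alpha>\<^sub>1 :: real and P :: "(real \<times> real) set" and e :: "nat \<Rightarrow> (real \<times> real) set"
  assumes P: "convex_polygon P" and sub: "P \<subseteq> unit_square"
    and a: "0 < \<alpha>\<^sub>1" "\<alpha>\<^sub>1 < 1"
    and e: "bij_betw e {1..N} {F. F edge_of P}"
    and npar: "\<And>k. k \<in> {1..N} \<Longrightarrow> \<not> parallel_to_segment (\<alpha>\<^sub>1, 1) (e k)"
    and par: "\<And>k. k \<in> {1..N} \<Longrightarrow> parallel_to_segment (rotate_vec (\<phi> k) (\<alpha>\<^sub>1, 1)) (e k)"
    and B: "\<And>k l. k \<in> {1..N} \<Longrightarrow> l \<in> {1..N} \<Longrightarrow> \<bar>cot (\<phi> k) - cot (\<phi> l)\<bar> \<le> B"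
  obtains f g :: "real \<Rightarrow> real"
  where "\<forall>u. f u = max 0 (g u)" "supporting_slopes (B / (1 + \<alpha>\<^sub>1\<^sup>2)) g"
    "\<forall>u. f u \<noteq> 0 \<longrightarrow> \<bar>u\<bar> \<le> 1"
    "\<forall>u. ((\<lambda>t. indicat_real P (u + \<alpha>\<^sub>1 * t, t)) has_integral f u) {0..1}"
    "(f has_integral measure lebesgue P) UNIV" "measure lebesgue P \<le> 1" "3 \<le> N"
proof -
  obtain U L where fin: "finite U" "finite L" and ne: "U \<noteq> {}" "L \<noteq> {}"
    and mem: "\<forall>u t. (u + \<alpha>\<^sub>1 * t, t) \<in> P \<longleftrightarrow> (\<forall>(m, c)\<in>U. t \<le> m * u + c) \<and> (\<forall>(m, c)\<in>L. m * u + c \<le> t)"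
    and slopes: "\<forall>(m, c)\<in>U \<union> L. \<exists>k\<in>{1..N}. m = edge_slope \<alpha>\<^sub>1 (\<phi> k)"
    and N3: "3 \<le> N"
    by (rule polygon_between_graphs[OF P e npar par])
  define hi where "hi = (\<lambda>u. Min ((\<lambda>(m, c). m * u + c) ` U))"
  define lo where "lo = (\<lambda>u. Max ((\<lambda>(m, c). m * u + c) ` L))"
  define g where "g = (\<lambda>u. hi u - lo u)"
  define f where "f = (\<lambda>u. max 0 (g u))"
  have sect: "(u + \<alpha>\<^sub>1 * t, t) \<in> P \<longleftrightarrow> t \<in> {lo u..hi u}" for u t
    unfolding mem[rule_format] hi_def lo_def using fin ne by (auto simp: Min_ge_iff Max_le_iff)
  have g: "supporting_slopes (B / (1 + \<alpha>\<^sub>1\<^sup>2)) g"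
    unfolding g_def hi_def lo_def
  proof (rule supporting_slopes_chord[OF fin ne])
    fix m c m' c' assume "(m, c) \<in> U" "(m', c') \<in> L"
    then obtain k l where "k \<in> {1..N}" "l \<in> {1..N}" "m = edge_slope \<alpha>\<^sub>1 (\<phi> k)" "m' = edge_slope \<alpha>\<^sub>1 (\<phi> l)"
      using slopes by blast
    then show "\<bar>m - m'\<bar> \<le> B / (1 + \<alpha>\<^sub>1\<^sup>2)" using edge_slope_diff_le[OF B] by blast
  qed
  have sect01: "{lo u..hi u} \<subseteq> {0..1}" for u
  proof
    fix t assume "t \<in> {lo u..hi u}"
    then have "(u + \<alpha>\<^sub>1 * t, t) \<in> unit_square" using sect sub by blast
    then show "t \<in> {0..1}" by (simp add: unit_square_def)
  qed
  have ind: "indicat_real P (u + \<alpha>\<^sub>1 * t, t) = indicat_real {lo u..hi u} t" for u t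
    using sect[of u t] by (auto simp: indicator_def)
  \<comment> \<open>On a chord both \<open>u + \<alpha>\<^sub>1 * t\<close> and
    \<open>\<alpha>\<^sub>1 * t\<close> lie in [0,1], so \<open>u\<close> is a difference of two
    such numbers.\<close>
  have supp: "\<bar>u\<bar> \<le> 1" if "f u \<noteq> 0" for u
  proof -
    have "lo u \<le> hi u" using that by (auto simp: f_def g_def max_def split: if_splits)
    then have "(u + \<alpha>\<^sub>1 * lo u, lo u) \<in> unit_square" using sect[of u "lo u"] sub by auto
    then have "0 \<le> u + \<alpha>\<^sub>1 * lo u" "u + \<alpha>\<^sub>1 * lo u \<le> 1" "0 \<le> lo u" "lo u \<le> 1"
      by (auto simp: unit_square_def)
    moreover from this have "0 \<le> \<alpha>\<^sub>1 * lo u" "\<alpha>\<^sub>1 * lo u \<le> 1" using a by (auto intro: mult_le_one)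
    ultimately show ?thesis by linarith
  qed
  have cell: "((\<lambda>t. indicat_real P (u + \<alpha>\<^sub>1 * t, t)) has_integral f u) {0..1}" for u
  proof -
    have "((\<lambda>_. 1 :: real) has_integral measure lborel {lo u..hi u}) {lo u..hi u}"
      using has_integral_const_real[of "1 :: real" "lo u" "hi u"] by simp
    \<comment> \<open>The chord is empty when \<open>hi u < lo u\<close>; the truncation at 0 in
      \<open>f\<close> then gives the correct length.\<close>
    then have "((\<lambda>t. if t \<in> {lo u..hi u} then 1 else 0) has_integral f u) {0..1}"
      by (subst has_integral_restrict[OF sect01]) (simp add: f_def g_def max_def)
    then show ?thesis unfolding ind by (simp add: indicator_def of_bool_def)
  qed
  have bor: "P \<in> sets borel"
    using P by (simp add: convex_polygon_def polytope_imp_closed borel_closed)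
  have meas: "emeasure lborel P = (\<integral>\<^sup>+u. ennreal (f u) \<partial>lborel)"
  proof -
    have "(\<integral>\<^sup>+t. indicator P (u + \<alpha>\<^sub>1 * t, t) \<partial>lborel) = ennreal (f u)" for u
    proof -
      have "(\<integral>\<^sup>+t. indicator P (u + \<alpha>\<^sub>1 * t, t) \<partial>lborel) = (\<integral>\<^sup>+t. indicator {lo u..hi u} t \<partial>lborel)"
        using sect[of u] by (intro nn_integral_cong) (simp add: indicator_def)
      also have "\<dots> = ennreal (f u)" by (simp add: f_def g_def max_def emeasure_lborel_Icc_eq)
      finally show ?thesis .
    qed
    then show ?thesis unfolding emeasure_shear[OF bor, of \<alpha>\<^sub>1] by simp
  qed
  have le1: "emeasure lborel P \<le> 1" by (rule measure_subset_unit_square[OF sub bor])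
  then have fin_em: "emeasure lborel P = ennreal (measure lborel P)"
    by (intro emeasure_eq_ennreal_measure) (auto simp: top_unique)
  have leb: "measure lebesgue P = measure lborel P" using bor by (simp add: measure_completion)
  show thesis
  proof (rule that[of f g])
    show "\<forall>u. f u = max 0 (g u)" by (simp add: f_def)
    show "\<forall>u. f u \<noteq> 0 \<longrightarrow> \<bar>u\<bar> \<le> 1" using supp by blast
    show "\<forall>u. ((\<lambda>t. indicat_real P (u + \<alpha>\<^sub>1 * t, t)) has_integral f u) {0..1}" using cell by blast
    have "continuous_on UNIV f"
      unfolding f_def by (intro continuous_intros supporting_slopes_continuous[OF g])
    then have "f \<in> borel_measurable borel" by (rule borel_measurable_continuous_onI)
    then show "(f has_integral measure lebesgue P) UNIV"
      using meas fin_em unfolding leb by (intro nn_integral_has_integral) (simp_all add: f_def)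
    show "measure lebesgue P \<le> 1" using le1 fin_em leb by simp
  qed (fact g N3)+
qed

section \<open>The discrepancy bound in the extended nonnegative reals\<close>

theorem theorem4:
  fixes \<alpha>\<^sub>1 T :: real and \<alpha> s :: "real \<times> real" and P :: "(real \<times> real) set"
    and N :: nat and e :: "nat \<Rightarrow> (real \<times> real) set" and \<phi> :: "nat \<Rightarrow> real"
  assumes "\<alpha> = (\<alpha>\<^sub>1, 1)" and "0 < \<alpha>\<^sub>1" and "\<alpha>\<^sub>1 < 1" and "\<alpha>\<^sub>1 \<notin> \<rat>"
    and "convex_polygon P" and "P \<subseteq> unit_square"
    and "bij_betw e {1..N} {F. F edge_of P}"
    and "\<And>k. k \<in> {1..N} \<Longrightarrow> \<not> parallel_to_segment \<alpha> (e k)"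
    and "\<And>k. k \<in> {1..N} \<Longrightarrow> parallel_to_segment (rotate_vec (\<phi> k) \<alpha>) (e k)"
    and "s \<in> unit_square" and "T > 0"
  shows "ennreal \<bar>discrepancy T s \<alpha> P\<bar> \<le>
    2 + ennreal ((real N + 1) / (pi\<^sup>2 * norm \<alpha>)
          * Max {\<bar>cot (\<phi> k) - cot (\<phi> l)\<bar> | k l. 1 \<le> k \<and> k < l \<and> l \<le> N})
        * (\<Sum>n. ennreal (1 / ((real (Suc n))\<^sup>2 * dist_nearest_int (real (Suc n) * \<alpha>\<^sub>1))))"
proof -
  define C where "C = {\<bar>cot (\<phi> k) - cot (\<phi> l)\<bar> | k l. 1 \<le> k \<and> k < l \<and> l \<le> N}"
  define t where "t = (\<lambda>n. 1 / ((real (Suc n))\<^sup>2 * dist_nearest_int (real (Suc n) * \<alpha>\<^sub>1)))"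
  have finC: "finite C"
  proof (rule finite_subset)
    show "C \<subseteq> (\<lambda>(k, l). \<bar>cot (\<phi> k) - cot (\<phi> l)\<bar>) ` ({1..N} \<times> {1..N})"
      unfolding C_def by force
  qed simp
  \<comment> \<open>The \<open>max 0\<close> covers \<open>k = l\<close>. That \<open>Max C\<close>
    is itself nonnegative is available only once \<open>3 \<le> N\<close> shows that
    \<open>C\<close> is nonempty.\<close>
  have pair: "\<bar>cot (\<phi> k) - cot (\<phi> l)\<bar> \<le> max 0 (Max C)" if "k \<in> {1..N}" "l \<in> {1..N}" for k l
  proof (cases "k = l")
    case False
    then have "\<bar>cot (\<phi> k) - cot (\<phi> l)\<bar> \<in> C"
    proof (cases "k < l")
      case True
      then show ?thesis using that unfolding C_def by auto
    next
      assume "\<not> k < l"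
      then have "1 \<le> l \<and> l < k \<and> k \<le> N" using that False by auto
      then have "\<bar>cot (\<phi> l) - cot (\<phi> k)\<bar> \<in> C" unfolding C_def by blast
      then show ?thesis by (simp add: abs_minus_commute)
    qed
    then show ?thesis using finC by (simp add: max.coboundedI2)
  qed simp
  obtain f g where f: "\<forall>u. f u = max 0 (g u)"
      and g: "supporting_slopes (max 0 (Max C) / (1 + \<alpha>\<^sub>1\<^sup>2)) g"
      and supp: "\<forall>u. f u \<noteq> 0 \<longrightarrow> \<bar>u\<bar> \<le> 1"
      and cell: "\<forall>u. ((\<lambda>t. indicat_real P (u + \<alpha>\<^sub>1 * t, t)) has_integral f u) {0..1}"
      and int: "(f has_integral measure lebesgue P) UNIV" and le1: "measure lebesgue P \<le> 1"
      and N: "3 \<le> N"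
    by (rule polygon_chord_function[OF assms(5,6,2,3,7) assms(8)[unfolded assms(1)] assms(9)[unfolded assms(1)] pair])
  have "\<bar>cot (\<phi> 1) - cot (\<phi> 2)\<bar> \<in> C" using N unfolding C_def by force
  then have "\<bar>cot (\<phi> 1) - cot (\<phi> 2)\<bar> \<le> Max C" using finC by simp
  then have C0: "0 \<le> Max C" by linarith
  have g': "supporting_slopes (Max C / (1 + \<alpha>\<^sub>1\<^sup>2)) g" using g C0 by (simp add: max_def)
  have intf: "integral UNIV f = measure lebesgue P" using int by (rule integral_unique)
  obtain M x where Mx: "\<forall>R::int. \<bar>x\<bar> + 2 * real M + 3 \<le> of_int R \<longrightarrow> \<bar>discrepancy T s (\<alpha>\<^sub>1, 1) P\<bar>
      \<le> 2 + \<bar>(\<Sum>n<M. \<Sum>m=-R..R. f (x + real n * \<alpha>\<^sub>1 + of_int m)) - real M * measure lebesgue P\<bar>"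
    by (rule discrepancy_le_orbit_sum[OF assms(6,2) less_imp_le[OF assms(3)] cell[rule_format] assms(10,11) le1])
  define R :: int where "R = \<lceil>\<bar>x\<bar> + 2 * real M + 3\<rceil>"
  have R: "\<bar>x\<bar> + 2 * real M + 3 \<le> of_int R" unfolding R_def by (rule le_of_int_ceiling)
  have t0: "0 \<le> t n" for n by (simp add: t_def dist_nearest_int_nonneg)
  define S where "S = (\<Sum>n. ennreal (t n))"
  have "ennreal \<bar>discrepancy T s \<alpha> P\<bar> \<le> 2 + ennreal ((real N + 1) / (pi\<^sup>2 * norm \<alpha>) * Max C) * S"
  \<comment> \<open>A zero coefficient annihilates even an infinite series, so the discrepancy must
    be at most 2 outright: \<open>g\<close> has slope bound 0 and is constant, and \<open>f\<close>,
    which vanishes at 2, is zero.\<close>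
  proof (cases "Max C = 0")
    case True
    have "f u = 0" for u
    proof -
      have "g u = g 2" using supporting_slopes_Lipschitz[OF g', of u 2] True by simp
      moreover have "f 2 = 0" using supp by force
      ultimately show ?thesis using f by simp
    qed
    then have f0: "f = (\<lambda>_. 0)" by blast
    have "measure lebesgue P = 0" using intf unfolding f0 by simp
    then have "\<bar>discrepancy T s (\<alpha>\<^sub>1, 1) P\<bar> \<le> 2"
      using Mx[rule_format, OF R] unfolding f0 by simp
    then have "ennreal \<bar>discrepancy T s \<alpha> P\<bar> \<le> ennreal 2" unfolding assms(1) by (rule ennreal_leI)
    then show ?thesis using True by simp
  next
    case False
    then have Cpos: "0 < Max C" using C0 by simp
    have coeff: "0 < (real N + 1) / (pi\<^sup>2 * norm \<alpha>) * Max C"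
      using Cpos by (intro mult_pos_pos divide_pos_pos) (auto simp: assms(1) zero_prod_def)
    show ?thesis
    proof (cases "S = top")
      case True
      \<comment> \<open>A positive coefficient times a divergent series makes the right side
        infinite.\<close>
      have "0 < ennreal ((real N + 1) / (pi\<^sup>2 * norm \<alpha>) * Max C)"
        using coeff by (simp only: ennreal_less_zero_iff)
      then have "ennreal ((real N + 1) / (pi\<^sup>2 * norm \<alpha>) * Max C) \<noteq> 0"
        by (rule less_imp_neq[THEN not_sym])
      then have "ennreal ((real N + 1) / (pi\<^sup>2 * norm \<alpha>) * Max C) * S = top"
        unfolding True ennreal_mult_eq_top_iff by simp
      then show ?thesis by (simp only: add_top_right_ennreal top_greatest)
    next
      case False
      define r where "r = enn2real S"
      have r: "S = ennreal r" "0 \<le> r" using False by (simp_all add: r_def top.not_eq_extremum)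
      have split: "ennreal (2 + c * r) = ennreal 2 + ennreal c * ennreal r" if "0 \<le> c" for c
        using that r(2) by (simp add: ennreal_plus ennreal_mult)
      have partial: "(\<Sum>k<n. t k) \<le> r" for n
      proof -
        have "ennreal (\<Sum>k<n. t k) = (\<Sum>k<n. ennreal (t k))" using t0 by (simp add: sum_ennreal)
        also have "\<dots> \<le> S" unfolding S_def by (intro sum_le_suminf) auto
        finally show ?thesis using r by (simp add: ennreal_le_iff)
      qed
      have "\<bar>(\<Sum>n<M. \<Sum>m=-R..R. f (x + real n * \<alpha>\<^sub>1 + of_int m)) - real M * integral UNIV f\<bar>
          \<le> 3 / 8 * (Max C / (1 + \<alpha>\<^sub>1\<^sup>2)) * r"
        using supp assms(2,3) R partial unfolding t_def
        by (intro orbit_sum_le[OF f[rule_format] g' _ assms(4)]) auto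
      also have "\<dots> \<le> (real N + 1) / (pi\<^sup>2 * norm \<alpha>) * Max C * r"
        unfolding assms(1) by (rule coefficient_le[OF N C0 r(2)])
      finally have "\<bar>discrepancy T s \<alpha> P\<bar> \<le> 2 + (real N + 1) / (pi\<^sup>2 * norm \<alpha>) * Max C * r"
        using Mx[rule_format, OF R] unfolding intf assms(1) by linarith
      then have "ennreal \<bar>discrepancy T s \<alpha> P\<bar> \<le> ennreal (2 + (real N + 1) / (pi\<^sup>2 * norm \<alpha>) * Max C * r)"
        by (rule ennreal_leI)
      also have "\<dots> = ennreal 2 + ennreal ((real N + 1) / (pi\<^sup>2 * norm \<alpha>) * Max C) * ennreal r"
        using split less_imp_le[OF coeff] by blast
      finally show ?thesis unfolding r(1) by simp
    qed
  qed
  then show ?thesis unfolding S_def t_def C_def .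
qed

end
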